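(* Let $n\ge4$, let $M$ be an $n$-dimensional smooth manifold and let $f_0,f_1$ be vector fields on $M$ such that $$\dim{\rm span}\bigl(f_0,f_1,[f_1,f_0],\dots,({\rm ad}f_1)^{n-2}f_0\bigr)=n,$$ $$\dim{\rm span}\bigl(f_1,[f_0,[f_0,f_1]],[f_1,f_0],\dots,({\rm ad}f_1)^{n-2}f_0\bigr)=n.$$ Then there exists a unique pair $(F_0,F_1)\in\mathcal O_{(f_0,f_1)}$ such that $$[F_0,[F_0,F_1]]=F_0+I_1F_1+I_2[F_1,F_0]+\sum_{k=3}^{n-2}I_k({\rm ad}F_1)^kF_0$$ for some functions $I_1,\dots,I_{n-2}$ on $M$.
   Context: All objects are $C^\infty$. $({\rm ad}f)g=[f,g]$; the dimension conditions are understood to hold at every point of $M$ (the setting is local). $\mathcal O_{(f_0,f_1)}=\{(f_0+\alpha f_1,\beta f_1):\alpha,\beta:M\to\mathbb R\text{ smooth functions},\ \beta\ne0 \text{ everywhere}\}$ is the orbit of $(f_0,f_1)$ under feedback transformations. For $n=4$ the sum over $k$ is empty. *)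

theory Defs
  imports "HOL-Analysis.Analysis" "HOL-Library.Function_Algebras"
begin

instantiation "fun" :: (type, real_vector) real_vector
begin

definition scaleR_fun :: "real \<Rightarrow> ('a \<Rightarrow> 'b) \<Rightarrow> 'a \<Rightarrow> 'b" where
  "scaleR_fun c f = (\<lambda>x. c *\<^sub>R f x)"

instance
  by standard (simp_all add: scaleR_fun_def fun_eq_iff scaleR_add_right scaleR_add_left)

end

text \<open>The set \<open>S\<close> is meant to be open in the following two definitions.\<close>

fun Ck_on :: "nat \<Rightarrow> 'a::euclidean_space set \<Rightarrow> ('a \<Rightarrow> 'b::real_normed_vector) \<Rightarrow> bool" where
  "Ck_on 0 S f \<longleftrightarrow> continuous_on S f"
| "Ck_on (Suc k) S f \<longleftrightarrow>
     (\<forall>x\<in>S. f differentiable (at x)) \<and>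
     (\<forall>v. Ck_on k S (\<lambda>x. frechet_derivative f (at x) v))"

definition smooth_on :: "'a::euclidean_space set \<Rightarrow> ('a \<Rightarrow> 'b::real_normed_vector) \<Rightarrow> bool" where
  "smooth_on S f \<longleftrightarrow> (\<forall>k. Ck_on k S f)"

text \<open>The underlying set of a manifold is a whole type. A chart is a pair of an open set
  and a coordinate map, whose values outside that set are irrelevant. The atlas need not be
  maximal; only the smooth structure that it generates enters below.\<close>

type_synonym ('m, 'n) chart = "'m set \<times> ('m \<Rightarrow> real ^ 'n)"

definition is_chart :: "('m::topological_space, 'n::finite) chart \<Rightarrow> bool" where
  "is_chart = (\<lambda>(U, \<phi>). open U \<and> open (\<phi> ` U) \<and> (\<exists>\<psi>. homeomorphism U (\<phi> ` U) \<phi> \<psi>))"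

definition smooth_atlas ::
  "('m::{t2_space, second_countable_topology}, 'n::finite) chart set \<Rightarrow> bool" where
  "smooth_atlas A \<longleftrightarrow>
     (\<forall>c\<in>A. is_chart c) \<and> (\<Union>(U, \<phi>)\<in>A. U) = UNIV \<and>
     (\<forall>(U, \<phi>)\<in>A. \<forall>(V, \<psi>)\<in>A. smooth_on (\<phi> ` (U \<inter> V)) (\<psi> \<circ> inv_into U \<phi>))"

definition smooth_fun :: "('m, 'n::finite) chart set \<Rightarrow> ('m \<Rightarrow> real) \<Rightarrow> bool" where
  "smooth_fun A f \<longleftrightarrow> (\<forall>(U, \<phi>)\<in>A. smooth_on (\<phi> ` U) (f \<circ> inv_into U \<phi>))"

text \<open>Tangent vectors are point derivations of the algebra of smooth functions. As
  functions are total, they are normalized to vanish on non-smooth arguments; otherwise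
  equality of tangent vectors would depend on junk values.\<close>

type_synonym 'm tangent = "('m \<Rightarrow> real) \<Rightarrow> real"
type_synonym 'm vfield = "'m \<Rightarrow> 'm tangent"

definition tangent_space :: "('m, 'n::finite) chart set \<Rightarrow> 'm \<Rightarrow> 'm tangent set" where
  "tangent_space A p =
     {v. (\<forall>f g. smooth_fun A f \<longrightarrow> smooth_fun A g \<longrightarrow> v (\<lambda>x. f x + g x) = v f + v g) \<and>
         (\<forall>c f. smooth_fun A f \<longrightarrow> v (\<lambda>x. c * f x) = c * v f) \<and>
         (\<forall>f g. smooth_fun A f \<longrightarrow> smooth_fun A g \<longrightarrow>
            v (\<lambda>x. f x * g x) = f p * v g + g p * v f) \<and>
         (\<forall>f. \<not> smooth_fun A f \<longrightarrow> v f = 0)}"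

definition vector_field :: "('m, 'n::finite) chart set \<Rightarrow> 'm vfield \<Rightarrow> bool" where
  "vector_field A X \<longleftrightarrow>
     (\<forall>p. X p \<in> tangent_space A p) \<and>
     (\<forall>f. smooth_fun A f \<longrightarrow> smooth_fun A (\<lambda>p. X p f))"

definition fscale :: "('m \<Rightarrow> real) \<Rightarrow> 'm vfield \<Rightarrow> 'm vfield" (infixr "\<cdot>" 75) where
  "\<alpha> \<cdot> X = (\<lambda>p. \<alpha> p *\<^sub>R X p)"

text \<open>On non-smooth \<open>f\<close> the bracket of two vector fields again gives 0, since both inner
  functions are then constantly 0.\<close>

definition lie_bracket :: "'m vfield \<Rightarrow> 'm vfield \<Rightarrow> 'm vfield" where
  "lie_bracket X Y = (\<lambda>p f. X p (\<lambda>q. Y q f) - Y p (\<lambda>q. X q f))"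

definition ad_pow :: "'m vfield \<Rightarrow> nat \<Rightarrow> 'm vfield \<Rightarrow> 'm vfield" where
  "ad_pow X k Y = (lie_bracket X ^^ k) Y"

definition feedback_orbit ::
  "('m, 'n::finite) chart set \<Rightarrow> 'm vfield \<Rightarrow> 'm vfield \<Rightarrow> ('m vfield \<times> 'm vfield) set" where
  "feedback_orbit A f0 f1 =
     {(f0 + \<alpha> \<cdot> f1, \<beta> \<cdot> f1) | \<alpha> \<beta>.
        smooth_fun A \<alpha> \<and> smooth_fun A \<beta> \<and> (\<forall>p. \<beta> p \<noteq> 0)}"

end

theory Submission
  imports Defs
begin

text \<open>Modulo \<open>f\<^sub>1\<close> and \<open>[f\<^sub>1, f\<^sub>0]\<close>, one has \<open>[F\<^sub>0, [F\<^sub>0, F\<^sub>1]] = \<beta> [f\<^sub>0, [f\<^sub>0, f\<^sub>1]] - \<alpha> \<beta> (ad f\<^sub>1)\<^sup>2 f\<^sub>0\<close>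
  for \<open>F\<^sub>0 = f\<^sub>0 + \<alpha> f\<^sub>1\<close> and \<open>F\<^sub>1 = \<beta> f\<^sub>1\<close>, and the module generated by \<open>f\<^sub>1\<close> and the \<open>(ad f\<^sub>1)\<^sup>j f\<^sub>0\<close>
  with \<open>1 \<le> j \<le> k\<close> is feedback invariant. Let \<open>a\<^sub>0\<close> be the coefficient of \<open>f\<^sub>0\<close> in the expansion of
  \<open>[f\<^sub>0, [f\<^sub>0, f\<^sub>1]]\<close> in the frame \<open>f\<^sub>0, f\<^sub>1, (ad f\<^sub>1)\<^sup>j f\<^sub>0\<close>; the second dimension condition says that it
  has no zeros. Comparing coefficients of \<open>f\<^sub>0\<close> forces \<open>\<beta> = 1 / a\<^sub>0\<close>. With \<open>f\<^sub>1\<close> replaced by \<open>\<beta> f\<^sub>1\<close>, the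
  absence of \<open>(ad F\<^sub>1)\<^sup>2 F\<^sub>0\<close> in the normal form then forces \<open>\<alpha>\<close> to be the coefficient of
  \<open>(ad f\<^sub>1)\<^sup>2 f\<^sub>0\<close>, and the remaining coefficients are absorbed by the \<open>I\<^sub>k\<close>. The tangent spaces,
  being spaces of derivations, have dimension at most \<open>n\<close> by Hadamard's lemma, and coefficients in a
  smooth frame are smooth by Cramer's rule.\<close>

section \<open>Functions of class \<open>C\<^sup>k\<close>\<close>

text \<open>The derivative at a point of an open set depends only on the values on that set, so the
  derivative functions agree on \<open>S\<close> as well and the recursion goes through.\<close>

lemma Ck_on_cong:
  assumes "open S" "\<And>x. x \<in> S \<Longrightarrow> f x = g x"
  shows "Ck_on k S f \<longleftrightarrow> Ck_on k S g"
  using assms(2)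
proof (induction k arbitrary: f g)
  case 0
  then show ?case by (simp cong: continuous_on_cong)
next
  case (Suc k)
  have d: "(f has_derivative D) (at x) \<longleftrightarrow> (g has_derivative D) (at x)" if "x \<in> S" for x D
    using has_derivative_transform_within_open[OF _ assms(1) that] Suc.prems by metis
  have "frechet_derivative f (at x) = frechet_derivative g (at x)" if "x \<in> S" for x
    using d[OF that] by (simp add: frechet_derivative_def)
  then have "Ck_on k S (\<lambda>x. frechet_derivative f (at x) v) \<longleftrightarrow>
      Ck_on k S (\<lambda>x. frechet_derivative g (at x) v)" for v
    by (intro Suc.IH) simp
  with d show ?case
    by (simp add: differentiable_def)
qed

lemma Ck_on_transform:
  "open S \<Longrightarrow> Ck_on k S g \<Longrightarrow> (\<And>x. x \<in> S \<Longrightarrow> f x = g x) \<Longrightarrow> Ck_on k S f"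
  using Ck_on_cong by blast

text \<open>Lets an explicit derivative \<open>D\<close> stand in for the choice-based
  \<open>frechet_derivative\<close>; most closure properties below are inductions whose step is this
  rule.\<close>

lemma Ck_on_SucI:
  assumes "open S" "\<And>x. x \<in> S \<Longrightarrow> (f has_derivative D x) (at x)"
    and "\<And>v. Ck_on k S (\<lambda>x. D x v)"
  shows "Ck_on (Suc k) S f"
proof -
  have "Ck_on k S (\<lambda>x. frechet_derivative f (at x) v)" for v
    using Ck_on_cong[OF assms(1), of "\<lambda>x. frechet_derivative f (at x) v" "\<lambda>x. D x v" k] assms(2,3)
    by (metis frechet_derivative_at)
  with assms(2) show ?thesis
    by (auto simp: differentiable_def)
qed

lemma Ck_on_SucD:
  assumes "Ck_on (Suc k) S f"
  shows "x \<in> S \<Longrightarrow> (f has_derivative frechet_derivative f (at x)) (at x)"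
    and "Ck_on k S (\<lambda>x. frechet_derivative f (at x) v)"
  using assms by (auto simp: frechet_derivative_works)

lemma Ck_on_Suc_imp: "Ck_on (Suc k) S f \<Longrightarrow> Ck_on k S f"
proof (induction k arbitrary: f)
  case 0
  then show ?case
    by (auto intro!: differentiable_imp_continuous_on differentiable_at_imp_differentiable_on)
next
  case (Suc k)
  then show ?case by (metis Ck_on.simps(2))
qed

lemma Ck_on_continuous: "Ck_on k S f \<Longrightarrow> continuous_on S f"
  by (induction k) (use Ck_on_Suc_imp in \<open>auto simp del: Ck_on.simps(2)\<close>)

lemma Ck_on_subset: "Ck_on k S f \<Longrightarrow> T \<subseteq> S \<Longrightarrow> Ck_on k T f"
  by (induction k arbitrary: f) (auto intro: continuous_on_subset)

text \<open>Serves where a function has a good formula only near each point, as for quotients with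
  varying denominators and for extensions by zero.\<close>

lemma Ck_on_local:
  assumes "\<And>x. x \<in> S \<Longrightarrow> \<exists>T. open T \<and> x \<in> T \<and> Ck_on k T f"
  shows "Ck_on k S f"
  using assms
proof (induction k arbitrary: f)
  case 0
  then show ?case
    by (metis Ck_on.simps(1) continuous_at_imp_continuous_on continuous_on_eq_continuous_at)
next
  case (Suc k)
  then show ?case
    by (metis Ck_on.simps(2))
qed

lemma Ck_on_const: "open S \<Longrightarrow> Ck_on k S (\<lambda>x. c)"
proof (induction k arbitrary: c)
  case (Suc k)
  then show ?case
    by (intro Ck_on_SucI[where D = "\<lambda>x v. 0"]) auto
qed simp

lemma Ck_on_add:
  assumes "open S" "Ck_on k S f" "Ck_on k S g"
  shows "Ck_on k S (\<lambda>x. f x + g x)"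
  using assms(2,3)
proof (induction k arbitrary: f g)
  case 0
  then show ?case by (simp add: continuous_on_add)
next
  case (Suc k)
  show ?case
    by (rule Ck_on_SucI[OF assms(1) has_derivative_add])
       (auto intro!: Suc.IH Ck_on_SucD[OF Suc.prems(1)] Ck_on_SucD[OF Suc.prems(2)])
qed

lemma Ck_on_bounded_linear:
  assumes "open S" "bounded_linear L" "Ck_on k S f"
  shows "Ck_on k S (\<lambda>x. L (f x))"
  using assms(3)
proof (induction k arbitrary: f)
  case 0
  then show ?case by (simp add: bounded_linear.continuous_on[OF assms(2)])
next
  case (Suc k)
  show ?case
    by (rule Ck_on_SucI[OF assms(1) bounded_linear.has_derivative[OF assms(2)]])
       (auto intro!: Suc.IH Ck_on_SucD[OF Suc.prems])
qed

lemma Ck_on_id: "open S \<Longrightarrow> Ck_on k S (\<lambda>x. x)"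
  by (cases k) (auto intro!: Ck_on_SucI[where D = "\<lambda>x v. v"] Ck_on_const simp del: Ck_on.simps(2))

lemma Ck_on_mult:
  fixes f g :: "_ \<Rightarrow> real"
  assumes "open S" "Ck_on k S f" "Ck_on k S g"
  shows "Ck_on k S (\<lambda>x. f x * g x)"
  using assms(2,3)
proof (induction k arbitrary: f g)
  case 0
  then show ?case by (simp add: continuous_on_mult)
next
  case (Suc k)
  note f = Suc.prems(1) and g = Suc.prems(2)
  show ?case
    by (rule Ck_on_SucI[OF assms(1) has_derivative_mult])
       (auto intro!: Ck_on_add Suc.IH assms(1) Ck_on_SucD[OF f] Ck_on_SucD[OF g]
          Ck_on_Suc_imp[OF f] Ck_on_Suc_imp[OF g])
qed

lemma Ck_on_sum:
  "open S \<Longrightarrow> (\<And>i. i \<in> I \<Longrightarrow> Ck_on k S (f i)) \<Longrightarrow> Ck_on k S (\<lambda>x. \<Sum>i\<in>I. f i x)"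
  by (induction I rule: infinite_finite_induct) (auto intro: Ck_on_add Ck_on_const)

text \<open>Up to sign, the derivative of \<open>1 / f\<close> is a derivative of \<open>f\<close>
  times two factors \<open>1 / f\<close>, so an induction on \<open>k\<close> for this one
  \<open>f\<close> suffices.\<close>

lemma Ck_on_inverse:
  fixes f :: "_ \<Rightarrow> real"
  assumes "open S" "Ck_on k S f" "\<And>x. x \<in> S \<Longrightarrow> f x \<noteq> 0"
  shows "Ck_on k S (\<lambda>x. inverse (f x))"
  using assms(2)
proof (induction k)
  case 0
  then show ?case using assms(3) by (auto intro: continuous_on_inverse)
next
  case (Suc k)
  note IH = Suc.IH[OF Ck_on_Suc_imp[OF Suc.prems]] and f = Ck_on_SucD[OF Suc.prems]
  show ?case
  proof (rule Ck_on_SucI[OF assms(1) Deriv.has_derivative_inverse])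
    show "Ck_on k S (\<lambda>x. - (inverse (f x) * frechet_derivative f (at x) v * inverse (f x)))" for v
      using Ck_on_bounded_linear[OF assms(1) bounded_linear_minus[OF bounded_linear_ident]]
        Ck_on_mult[OF assms(1)] IH f(2) by blast
  qed (use f assms(3) in auto)
qed

text \<open>Induction on \<open>k\<close> with \<open>f\<close> fixed and \<open>g\<close> varying:
  the chain rule expresses the derivative of the composite by derivatives of \<open>g\<close> along
  basis vectors, composed with the same \<open>f\<close>.\<close>

lemma Ck_on_compose:
  fixes f :: "'a::euclidean_space \<Rightarrow> 'b::euclidean_space" and g :: "'b \<Rightarrow> real"
  assumes "open S" "open T" "f ` S \<subseteq> T" "Ck_on k S f" "Ck_on k T g"
  shows "Ck_on k S (\<lambda>x. g (f x))"
  using assms(4,5)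
proof (induction k arbitrary: g)
  case 0
  then show ?case using assms(3) by (auto intro: continuous_on_compose2)
next
  case (Suc k)
  let ?Df = "\<lambda>x. frechet_derivative f (at x)" and ?Dg = "\<lambda>y. frechet_derivative g (at y)"
  note f = Ck_on_SucD[OF Suc.prems(1)] and g = Ck_on_SucD[OF Suc.prems(2)]
  \<comment> \<open>The direction \<open>?Df x v\<close> moves with \<open>x\<close>, whereas
    \<open>Ck_on\<close> speaks of derivatives in fixed directions; expanding it in the basis
    separates the two.\<close>
  have lin: "?Dg (f x) (?Df x v) = (\<Sum>b\<in>Basis. (?Df x v \<bullet> b) * ?Dg (f x) b)" if "x \<in> S" for x v
  proof -
    have "linear (?Dg (f x))"
      using g(1)[of "f x"] that assms(3) has_derivative_linear by blast
    then show ?thesis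
      by (subst euclidean_representation[of "?Df x v", symmetric])
         (simp add: linear_sum linear_scale)
  qed
  show ?case
  proof (rule Ck_on_SucI[OF assms(1)])
    show "((\<lambda>x. g (f x)) has_derivative (\<lambda>v. \<Sum>b\<in>Basis. (?Df x v \<bullet> b) * ?Dg (f x) b)) (at x)"
      if "x \<in> S" for x
    proof -
      have "(g has_derivative ?Dg (f x)) (at (f x) within range f)"
        using g(1)[of "f x"] that assms(3) has_derivative_at_withinI by blast
      then show ?thesis
        using has_derivative_in_compose[OF f(1)[OF that], of g "?Dg (f x)"] lin[OF that] by simp
    qed
    show "Ck_on k S (\<lambda>x. \<Sum>b\<in>Basis. (?Df x v \<bullet> b) * ?Dg (f x) b)" for v
    proof (intro Ck_on_sum Ck_on_mult assms(1))
      fix b :: 'b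
      show "Ck_on k S (\<lambda>x. ?Df x v \<bullet> b)"
        by (rule Ck_on_bounded_linear[OF assms(1) bounded_linear_inner_left f(2)])
      show "Ck_on k S (\<lambda>x. ?Dg (f x) b)"
        using Suc.IH[OF Ck_on_Suc_imp[OF Suc.prems(1)] g(2)] .
    qed
  qed
qed

section \<open>Hadamard's lemma and bump functions\<close>

text \<open>Differentiation under the integral sign. The chain rule along the ray contributes one
  factor \<open>t\<close> per derivative, which is why the weight \<open>t ^ m\<close> is carried
  along and \<open>m\<close> varies in the induction.\<close>

lemma Ck_on_integral_ray:
  fixes h :: "'a::euclidean_space \<Rightarrow> real"
  assumes "Ck_on k (ball a r) h"
  shows "Ck_on k (ball a r) (\<lambda>x. integral {0..1} (\<lambda>t. t ^ m * h (a + t *\<^sub>R (x - a))))"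
  using assms
proof (induction k arbitrary: m h)
  have ray: "a + t *\<^sub>R (x - a) \<in> ball a r" if "x \<in> ball a r" "t \<in> {0..1}" for x t
  proof -
    have "norm (t *\<^sub>R (x - a)) \<le> norm (x - a)"
      using that by (simp add: mult_left_le_one_le)
    with that show ?thesis
      by (simp add: dist_norm norm_minus_commute)
  qed
  have cont: "continuous_on (ball a r \<times> cbox 0 1) (\<lambda>(x, t). t ^ m * h (a + t *\<^sub>R (x - a)))"
    if "continuous_on (ball a r) h" for h :: "'a \<Rightarrow> real" and m
    unfolding split_beta
    by (intro continuous_intros continuous_on_compose2[OF that]) (use ray in auto)
  {
    case 0
    then show ?case
      using integral_continuous_on_param[OF cont] by simp
  next
    case (Suc k)
    let ?D = "\<lambda>x. frechet_derivative h (at x)"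
    note h = Ck_on_SucD[OF Suc.prems]
    \<comment> \<open>The derivative of the integrand in \<open>x\<close> as a bounded linear map,
      the form in which the Leibniz rule takes it. Built from basis directions, it is visibly
      continuous in \<open>x\<close> and \<open>t\<close> jointly.\<close>
    define L where "L x t = (\<Sum>b\<in>Basis. (t ^ Suc m * ?D (a + t *\<^sub>R (x - a)) b) *\<^sub>R blinfun_inner_left b)"
      for x t
    have L: "blinfun_apply (L x t) v = t ^ Suc m * ?D (a + t *\<^sub>R (x - a)) v"
      if "x \<in> ball a r" "t \<in> {0..1}" for x t v
    proof -
      have "linear (?D (a + t *\<^sub>R (x - a)))"
        using h(1)[OF ray[OF that]] has_derivative_linear by blast
      then have "?D (a + t *\<^sub>R (x - a)) v = (\<Sum>b\<in>Basis. (v \<bullet> b) * ?D (a + t *\<^sub>R (x - a)) b)"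
        by (subst euclidean_representation[of v, symmetric]) (simp add: linear_sum linear_scale)
      then show ?thesis
        by (simp add: L_def blinfun.sum_left blinfun.scaleR_left sum_distrib_left algebra_simps)
    qed
    have contL: "continuous_on (ball a r \<times> cbox 0 1) (\<lambda>(x, t). L x t)"
      using cont[of _ "Suc m", OF Ck_on_continuous[OF h(2)]] unfolding L_def split_beta
      by (intro continuous_on_sum continuous_on_scaleR continuous_on_const)
    have intL: "L x integrable_on {0..1}" if "x \<in> ball a r" for x
    proof -
      have "continuous_on {0..1} (\<lambda>t. (\<lambda>(x, t). L x t) (x, t))"
        by (rule continuous_on_compose2[OF contL]) (use that in \<open>auto intro!: continuous_intros\<close>)
      then show ?thesis by (auto intro: integrable_continuous_real)
    qed
    show ?case
    proof (rule Ck_on_SucI[OF open_ball])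
      show "((\<lambda>x. integral {0..1} (\<lambda>t. t ^ m * h (a + t *\<^sub>R (x - a)))) has_derivative
          blinfun_apply (integral {0..1} (L x))) (at x)" if x: "x \<in> ball a r" for x
      proof -
        have "((\<lambda>x. integral (cbox 0 1) (\<lambda>t. t ^ m * h (a + t *\<^sub>R (x - a)))) has_derivative
          blinfun_apply (integral (cbox 0 1) (L x))) (at x within ball a r)"
        proof (rule leibniz_rule[OF _ _ contL x convex_ball])
          show "((\<lambda>x. t ^ m * h (a + t *\<^sub>R (x - a))) has_derivative blinfun_apply (L x t))
              (at x within ball a r)" if "x \<in> ball a r" "t \<in> cbox 0 1" for x t
          proof -
            have t: "t \<in> {0..1}" using that by simp
            have *: "((\<lambda>x. a + t *\<^sub>R (x - a)) has_derivative (*\<^sub>R) t) (at x within ball a r)"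
              by (auto intro!: derivative_eq_intros)
            have "(h has_derivative ?D (a + t *\<^sub>R (x - a)))
                (at (a + t *\<^sub>R (x - a)) within (\<lambda>x. a + t *\<^sub>R (x - a)) ` ball a r)"
              using h(1)[OF ray[OF that(1) t]] has_derivative_at_withinI by blast
            from has_derivative_in_compose[OF * this]
            have "((\<lambda>x. h (a + t *\<^sub>R (x - a))) has_derivative (\<lambda>v. ?D (a + t *\<^sub>R (x - a)) (t *\<^sub>R v)))
                (at x within ball a r)" .
            moreover have "linear (?D (a + t *\<^sub>R (x - a)))"
              using h(1)[OF ray[OF that(1) t]] has_derivative_linear by blast
            ultimately have "((\<lambda>x. t ^ m * h (a + t *\<^sub>R (x - a))) has_derivative
                (\<lambda>v. t ^ m * (t * ?D (a + t *\<^sub>R (x - a)) v))) (at x within ball a r)"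
              using has_derivative_mult_right[of "\<lambda>x. h (a + t *\<^sub>R (x - a))"]
              by (simp add: linear_scale)
            then show ?thesis
              by (rule has_derivative_eq_rhs) (use L[OF that(1) t] in \<open>simp add: fun_eq_iff mult.assoc mult.left_commute\<close>)
          qed
          show "(\<lambda>t. t ^ m * h (a + t *\<^sub>R (x - a))) integrable_on cbox 0 1" if "x \<in> ball a r" for x
          proof -
            have "continuous_on {0..1} (\<lambda>t. (\<lambda>(x, t). t ^ m * h (a + t *\<^sub>R (x - a))) (x, t))"
              by (rule continuous_on_compose2[OF cont[OF Ck_on_continuous[OF Suc.prems]]])
                 (use that in \<open>auto intro!: continuous_intros\<close>)
            then show ?thesis by (auto intro: integrable_continuous_real)
          qed
        qed
        then show ?thesis using x by (simp add: at_within_open[OF x open_ball])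
      qed
      show "Ck_on k (ball a r) (\<lambda>x. blinfun_apply (integral {0..1} (L x)) v)" for v
      proof -
        have "blinfun_apply (integral {0..1} (L x)) v =
            integral {0..1} (\<lambda>t. t ^ Suc m * ?D (a + t *\<^sub>R (x - a)) v)" if "x \<in> ball a r" for x
          unfolding blinfun_apply_integral[OF intL[OF that]]
          by (rule integral_cong) (use L[OF that] in auto)
        then show ?thesis
          using Suc.IH[OF h(2), of "Suc m" v] Ck_on_cong[OF open_ball] by (metis (no_types, lifting))
      qed
    qed
  }
qed

text \<open>The fundamental theorem of calculus along the segment from \<open>a\<close> to
  \<open>x\<close>; \<open>g b\<close> is the average over the segment of the derivative in
  direction \<open>b\<close>.\<close>

lemma hadamard:
  fixes f :: "'a::euclidean_space \<Rightarrow> real"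
  assumes "smooth_on (ball a r) f" "0 < r"
  obtains g where "\<And>b. b \<in> Basis \<Longrightarrow> smooth_on (ball a r) (g b)"
    and "\<And>b. b \<in> Basis \<Longrightarrow> g b a = frechet_derivative f (at a) b"
    and "\<And>x. x \<in> ball a r \<Longrightarrow> f x = f a + (\<Sum>b\<in>Basis. ((x - a) \<bullet> b) * g b x)"
proof
  let ?D = "\<lambda>x. frechet_derivative f (at x)"
  define g where "g b x = integral {0..1} (\<lambda>t. ?D (a + t *\<^sub>R (x - a)) b)" for b x
  have f: "x \<in> ball a r \<Longrightarrow> (f has_derivative ?D x) (at x)" "Ck_on k (ball a r) (\<lambda>x. ?D x b)" for x b k
    using assms(1) Ck_on_SucD[of k "ball a r" f] by (auto simp: smooth_on_def simp del: Ck_on.simps)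
  show "smooth_on (ball a r) (g b)" for b
    using Ck_on_integral_ray[OF f(2), of _ 0] by (simp add: smooth_on_def g_def[abs_def])
  show "g b a = ?D a b" for b
    by (simp add: g_def)
  show "f x = f a + (\<Sum>b\<in>Basis. ((x - a) \<bullet> b) * g b x)" if x: "x \<in> ball a r" for x
  proof -
    have ray: "a + t *\<^sub>R (x - a) \<in> ball a r" if "t \<in> {0..1}" for t
    proof -
      have "norm (t *\<^sub>R (x - a)) \<le> norm (x - a)"
        using that by (simp add: mult_left_le_one_le)
      with x show ?thesis
        by (simp add: dist_norm norm_minus_commute)
    qed
    have "((\<lambda>t. ?D (a + t *\<^sub>R (x - a)) (x - a)) has_integral
        f (a + 1 *\<^sub>R (x - a)) - f (a + 0 *\<^sub>R (x - a))) {0..1}"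
    proof (rule fundamental_theorem_of_calculus)
      fix t :: real assume t: "t \<in> {0..1}"
      have *: "((\<lambda>t. a + t *\<^sub>R (x - a)) has_derivative (\<lambda>s. s *\<^sub>R (x - a))) (at t within {0..1})"
        by (auto intro!: derivative_eq_intros)
      have "(f has_derivative ?D (a + t *\<^sub>R (x - a)))
          (at (a + t *\<^sub>R (x - a)) within (\<lambda>t. a + t *\<^sub>R (x - a)) ` {0..1})"
        using f(1)[OF ray[OF t]] has_derivative_at_withinI by blast
      from has_derivative_in_compose[OF * this]
      have "((\<lambda>t. f (a + t *\<^sub>R (x - a))) has_derivative (\<lambda>s. ?D (a + t *\<^sub>R (x - a)) (s *\<^sub>R (x - a))))
          (at t within {0..1})" .
      moreover have "linear (?D (a + t *\<^sub>R (x - a)))"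
        using f(1)[OF ray[OF t]] has_derivative_linear by blast
      ultimately show "((\<lambda>t. f (a + t *\<^sub>R (x - a))) has_vector_derivative
          ?D (a + t *\<^sub>R (x - a)) (x - a)) (at t within {0..1})"
        by (simp add: has_vector_derivative_def linear_scale)
    qed simp
    then have "f x - f a = integral {0..1} (\<lambda>t. ?D (a + t *\<^sub>R (x - a)) (x - a))"
      by (simp add: integral_unique)
    also have "\<dots> = integral {0..1} (\<lambda>t. \<Sum>b\<in>Basis. ((x - a) \<bullet> b) * ?D (a + t *\<^sub>R (x - a)) b)"
    proof (rule integral_cong)
      fix t :: real assume t: "t \<in> {0..1}"
      have "linear (?D (a + t *\<^sub>R (x - a)))"
        using f(1)[OF ray[OF t]] has_derivative_linear by blast
      from linear_sum[OF this, of "\<lambda>b. ((x - a) \<bullet> b) *\<^sub>R b" Basis]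
      show "?D (a + t *\<^sub>R (x - a)) (x - a) = (\<Sum>b\<in>Basis. ((x - a) \<bullet> b) * ?D (a + t *\<^sub>R (x - a)) b)"
        using linear_scale[OF \<open>linear (?D (a + t *\<^sub>R (x - a)))\<close>]
        by (simp add: euclidean_representation)
    qed
    also have "\<dots> = (\<Sum>b\<in>Basis. ((x - a) \<bullet> b) * g b x)"
    proof -
      have "(\<lambda>t. ?D (a + t *\<^sub>R (x - a)) b) integrable_on {0..1}" for b
        by (intro integrable_continuous_real continuous_on_compose2[OF Ck_on_continuous[OF f(2)]])
           (use ray in \<open>auto intro!: continuous_intros\<close>)
      then show ?thesis
        unfolding g_def by (subst integral_sum) (auto intro: integrable_on_mult_right)
    qed
    finally show ?thesis by simp
  qed
qed

text \<open>For these functions the derivative of \<open>h m\<close> is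
  \<open>h (m + 2) - m * h (m + 1)\<close>. The family is thus closed under differentiation up to
  linear combinations, and one induction with \<open>m\<close> varying handles all orders.\<close>

lemma bump_1D:
  fixes m :: nat
  defines "h \<equiv> (\<lambda>m t. if 0 < t then inverse t ^ m * exp (- inverse t) else (0::real))"
  shows "Ck_on k UNIV (h m)"
proof (induction k arbitrary: m)
  have lim: "((\<lambda>t. h m t) \<longlongrightarrow> 0) (at 0)" for m
  proof -
    have "((\<lambda>t. inverse t ^ m / exp (inverse t)) \<longlongrightarrow> 0) (at_right (0::real))"
      using filterlim_compose[OF tendsto_power_div_exp_0 filterlim_inverse_at_top_right] by simp
    then have "(h m \<longlongrightarrow> 0) (at_right 0)"
      by (rule Lim_transform_eventually)
         (auto simp: h_def eventually_at_filter exp_minus field_simps)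
    moreover have "(h m \<longlongrightarrow> 0) (at_left 0)"
      by (rule tendsto_eventually) (auto simp: h_def eventually_at_filter)
    ultimately show ?thesis
      by (simp add: filterlim_split_at)
  qed
  have der: "(h m has_field_derivative h (m + 2) t - real m * h (m + 1) t) (at t)" for m t
  proof (cases "t = 0")
    case True
    \<comment> \<open>At 0 the difference quotient of \<open>h m\<close> is
      \<open>h (Suc m)\<close>, whose limit there is already known to be 0.\<close>
    have "((\<lambda>s. (h m s - h m 0) / (s - 0)) \<longlongrightarrow> 0) (at 0)"
      by (rule Lim_transform_eventually[OF lim[of "Suc m"]])
         (auto simp: h_def eventually_at_filter field_simps)
    then show ?thesis
      using True by (simp add: has_field_derivative_iff h_def)
  next
    case False
    show ?thesis
    proof (cases "0 < t")
      case True
      have "((\<lambda>t. inverse t ^ m * exp (- inverse t)) has_field_derivative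
          h (m + 2) t - real m * h (m + 1) t) (at t)"
        using True
        by (auto intro!: derivative_eq_intros simp: h_def)
           (cases m; auto simp: field_simps power2_eq_square)
      then show ?thesis
        by (rule has_field_derivative_transform_within_open[where S = "{0<..}"])
           (use True in \<open>auto simp: h_def\<close>)
    next
      case F: False
      have "((\<lambda>t. 0) has_field_derivative h (m + 2) t - real m * h (m + 1) t) (at t)"
        using F by (simp add: h_def)
      then show ?thesis
        by (rule has_field_derivative_transform_within_open[where S = "{..<0}"])
           (use False F in \<open>auto simp: h_def\<close>)
    qed
  qed
  {
    case 0
    then show ?case
      using DERIV_isCont[OF der] by (simp add: continuous_at_imp_continuous_on)
  next
    case (Suc k)
    show ?case
    proof (rule Ck_on_SucI[OF open_UNIV])
      show "(h m has_derivative (*) (h (m + 2) t - real m * h (m + 1) t)) (at t)" for t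
        using der by (simp add: has_field_derivative_def)
      have "Ck_on k UNIV (\<lambda>t. v * h (m + 2) t + (- v * real m) * h (m + 1) t)" for v
        by (intro Ck_on_add Ck_on_mult Ck_on_const Suc.IH open_UNIV)
      then show "Ck_on k UNIV (\<lambda>t. (h (m + 2) t - real m * h (m + 1) t) * v)" for v
        by (simp add: algebra_simps)
    qed
  }
qed

text \<open>The flat function of \<open>bump_1D\<close> with \<open>m = 0\<close> is evaluated at
  \<open>r\<^sup>2 - (norm (x - a))\<^sup>2\<close>, a polynomial in the coordinates that is
  positive exactly on the ball.\<close>

lemma bump_exists:
  fixes a :: "'a::euclidean_space"
  assumes "0 < r"
  obtains b :: "'a \<Rightarrow> real" where "smooth_on UNIV b" "b a \<noteq> 0" "\<And>x. x \<notin> ball a r \<Longrightarrow> b x = 0"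
proof
  define h where "h t = (if 0 < t then inverse t ^ 0 * exp (- inverse t) else (0::real))" for t
  let ?b = "\<lambda>x. h (r\<^sup>2 - (x - a) \<bullet> (x - a))"
  have "Ck_on k UNIV (\<lambda>x. (\<Sum>i\<in>Basis. (x \<bullet> i + - (a \<bullet> i)) * (x \<bullet> i + - (a \<bullet> i))))" for k
    by (intro Ck_on_sum Ck_on_mult Ck_on_add Ck_on_const open_UNIV
        Ck_on_bounded_linear[OF open_UNIV bounded_linear_inner_left] Ck_on_id)
  then have "Ck_on k UNIV (\<lambda>x. (x - a) \<bullet> (x - a))" for k
    by (subst euclidean_inner) (simp add: inner_diff_left)
  then have "Ck_on k UNIV (\<lambda>x. r\<^sup>2 + (- 1) * ((x - a) \<bullet> (x - a)))" for k
    by (intro Ck_on_mult Ck_on_add Ck_on_const open_UNIV)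
  then have "Ck_on k UNIV (\<lambda>x. r\<^sup>2 - (x - a) \<bullet> (x - a))" for k
    by simp
  then show "smooth_on UNIV ?b"
    unfolding smooth_on_def h_def
    by (intro allI Ck_on_compose[OF open_UNIV open_UNIV _ _ bump_1D]) simp_all
  show "?b a \<noteq> 0"
    using assms by (simp add: h_def)
  show "?b x = 0" if "x \<notin> ball a r" for x
  proof -
    have "r \<le> norm (x - a)"
      using that by (simp add: dist_norm norm_minus_commute)
    then have "r\<^sup>2 \<le> (x - a) \<bullet> (x - a)"
      using assms by (simp add: power2_norm_eq_inner[symmetric] power_mono)
    then show ?thesis by (simp add: h_def)
  qed
qed

section \<open>Smooth functions and tangent vectors\<close>

lemma sum_fun_apply: "(\<Sum>i\<in>I. f i) x = (\<Sum>i\<in>I. f i x)"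
  by (induction I rule: infinite_finite_induct) (auto simp: zero_fun_def plus_fun_def)

locale atlas =
  fixes A :: "('m::{t2_space, second_countable_topology}, 'n::finite) chart set"
  assumes atlas: "smooth_atlas A"
begin

lemma
  assumes "(U, \<phi>) \<in> A"
  shows chart_open: "open U"
    and chart_inj: "inj_on \<phi> U"
    and chart_continuous: "continuous_on U \<phi>"
    and chart_inv_continuous: "continuous_on (\<phi> ` U) (inv_into U \<phi>)"
    and chart_open_image: "\<And>W. open W \<Longrightarrow> W \<subseteq> U \<Longrightarrow> open (\<phi> ` W)"
proof -
  from assms atlas obtain \<psi> where *: "open U" "open (\<phi> ` U)" "homeomorphism U (\<phi> ` U) \<phi> \<psi>"
    by (force simp: smooth_atlas_def is_chart_def)
  then show "open U" "continuous_on U \<phi>"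
    by (auto simp: homeomorphism_def)
  show inj: "inj_on \<phi> U"
    using * by (metis homeomorphism_apply1 inj_onI)
  \<comment> \<open>\<open>smooth_fun\<close> and \<open>smooth_atlas\<close> invert a chart by
    \<open>inv_into\<close>, while a chart only comes with some inverse \<open>\<psi>\<close>; on
    the image the two agree.\<close>
  have "inv_into U \<phi> y = \<psi> y" if "y \<in> \<phi> ` U" for y
    using * that inj by (metis f_inv_into_f homeomorphism_apply1 inv_into_into)
  then show "continuous_on (\<phi> ` U) (inv_into U \<phi>)"
    using * by (metis continuous_on_cong homeomorphism_cont2)
  show "open (\<phi> ` W)" if "open W" "W \<subseteq> U" for W
    using homeomorphism_imp_open_map[OF *(3), of W] that * by (simp add: openin_open_eq)
qed

lemma chart_cover: obtains U \<phi> where "(U, \<phi>) \<in> A" "p \<in> U"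
proof -
  have "p \<in> (\<Union>(U, \<phi>)\<in>A. U)"
    using atlas by (simp add: smooth_atlas_def)
  then show thesis
    using that by auto
qed

lemma chart_transition:
  "(U, \<phi>) \<in> A \<Longrightarrow> (V, \<psi>) \<in> A \<Longrightarrow> Ck_on k (\<phi> ` (U \<inter> V)) (\<psi> \<circ> inv_into U \<phi>)"
proof -
  assume "(U, \<phi>) \<in> A" "(V, \<psi>) \<in> A"
  moreover have "\<forall>(U, \<phi>)\<in>A. \<forall>(V, \<psi>)\<in>A. smooth_on (\<phi> ` (U \<inter> V)) (\<psi> \<circ> inv_into U \<phi>)"
    using atlas by (simp add: smooth_atlas_def)
  ultimately show ?thesis
    unfolding smooth_on_def by blast
qed

section \<open>The algebra of smooth functions\<close>

lemma smooth_fun_Ck_on: "smooth_fun A f \<Longrightarrow> (U, \<phi>) \<in> A \<Longrightarrow> Ck_on k (\<phi> ` U) (\<lambda>x. f (inv_into U \<phi> x))"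
  by (auto simp: smooth_fun_def smooth_on_def comp_def dest!: bspec)

lemma smooth_funI:
  "(\<And>U \<phi> k. (U, \<phi>) \<in> A \<Longrightarrow> Ck_on k (\<phi> ` U) (\<lambda>x. f (inv_into U \<phi> x))) \<Longrightarrow> smooth_fun A f"
  by (auto simp: smooth_fun_def smooth_on_def comp_def dest!: bspec)

lemma chart_range_open: "(U, \<phi>) \<in> A \<Longrightarrow> open (\<phi> ` U)"
  using chart_open_image chart_open by blast

lemma smooth_fun_const: "smooth_fun A (\<lambda>x. c)"
  by (rule smooth_funI) (intro Ck_on_const chart_range_open)

lemma smooth_fun_add: "smooth_fun A f \<Longrightarrow> smooth_fun A g \<Longrightarrow> smooth_fun A (\<lambda>x. f x + g x)"
  by (rule smooth_funI) (intro Ck_on_add chart_range_open smooth_fun_Ck_on)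

lemma smooth_fun_mult: "smooth_fun A f \<Longrightarrow> smooth_fun A g \<Longrightarrow> smooth_fun A (\<lambda>x. f x * g x)"
  by (rule smooth_funI) (intro Ck_on_mult chart_range_open smooth_fun_Ck_on)

lemma smooth_fun_minus: "smooth_fun A f \<Longrightarrow> smooth_fun A (\<lambda>x. - f x)"
  using smooth_fun_mult[OF smooth_fun_const[of "-1"]] by simp

lemma smooth_fun_diff: "smooth_fun A f \<Longrightarrow> smooth_fun A g \<Longrightarrow> smooth_fun A (\<lambda>x. f x - g x)"
  using smooth_fun_add[OF _ smooth_fun_minus] by simp

lemma smooth_fun_sum: "(\<And>i. i \<in> I \<Longrightarrow> smooth_fun A (f i)) \<Longrightarrow> smooth_fun A (\<lambda>x. \<Sum>i\<in>I. f i x)"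
  by (rule smooth_funI) (intro Ck_on_sum chart_range_open smooth_fun_Ck_on)

lemma smooth_fun_prod: "(\<And>i. i \<in> I \<Longrightarrow> smooth_fun A (f i)) \<Longrightarrow> smooth_fun A (\<lambda>x. \<Prod>i\<in>I. f i x)"
  by (induction I rule: infinite_finite_induct) (auto intro: smooth_fun_mult smooth_fun_const)

lemma smooth_fun_inverse:
  "smooth_fun A f \<Longrightarrow> (\<And>p. f p \<noteq> 0) \<Longrightarrow> smooth_fun A (\<lambda>x. inverse (f x))"
  by (rule smooth_funI) (intro Ck_on_inverse chart_range_open smooth_fun_Ck_on)

text \<open>Near \<open>p\<close> the denominator \<open>D\<close> stays nonzero by continuity and
  \<open>f\<close> is the quotient \<open>N / D\<close> there. The pair may change with
  \<open>p\<close>, as the functions used in Cramer's rule do.\<close>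

lemma smooth_fun_local_quotient:
  assumes "\<And>p. \<exists>N D. smooth_fun A N \<and> smooth_fun A D \<and> D p \<noteq> 0 \<and> (\<forall>q. D q * f q = N q)"
  shows "smooth_fun A f"
proof (intro smooth_funI Ck_on_local)
  fix U \<phi> k x assume chart: "(U, \<phi>) \<in> A" and x: "x \<in> \<phi> ` U"
  let ?\<iota> = "inv_into U \<phi>"
  from assms[of "?\<iota> x"] obtain N D where ND: "smooth_fun A N" "smooth_fun A D"
    "D (?\<iota> x) \<noteq> 0" "\<And>q. D q * f q = N q"
    by auto
  let ?T = "\<phi> ` U \<inter> (\<lambda>y. D (?\<iota> y)) -` (- {0})"
  have T: "open ?T"
    by (intro continuous_open_preimage Ck_on_continuous[OF smooth_fun_Ck_on[OF ND(2) chart]]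
        chart_range_open[OF chart] open_Compl closed_singleton)
  have "Ck_on k ?T (\<lambda>y. N (?\<iota> y) * inverse (D (?\<iota> y)))"
    by (intro Ck_on_mult Ck_on_inverse T Ck_on_subset[OF smooth_fun_Ck_on[OF _ chart]] ND) auto
  moreover have "f (?\<iota> y) = N (?\<iota> y) * inverse (D (?\<iota> y))" if "y \<in> ?T" for y
    using that ND(4)[of "?\<iota> y"] by (auto simp: field_simps)
  ultimately have "Ck_on k ?T (\<lambda>y. f (?\<iota> y))"
    by (rule Ck_on_transform[OF T])
  with T x ND(3) show "\<exists>T. open T \<and> x \<in> T \<and> Ck_on k T (\<lambda>y. f (?\<iota> y))"
    by (intro exI[of _ ?T]) auto
qed

text \<open>Near a point of \<open>U\<close> with coordinates in \<open>G\<close> the function is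
  \<open>h\<close> after a smooth transition map; every other point has a neighbourhood that misses
  the copy of \<open>K\<close> in \<open>U\<close>, and there the function is 0.\<close>

lemma smooth_fun_extend_zero:
  assumes chart: "(U, \<phi>) \<in> A" and G: "open G" "G \<subseteq> \<phi> ` U" and K: "compact K" "K \<subseteq> G"
    and h: "smooth_on G h" "\<And>x. x \<notin> K \<Longrightarrow> h x = 0"
  shows "smooth_fun A (\<lambda>q. if q \<in> U then h (\<phi> q) else 0)" (is "smooth_fun A ?Z")
proof (intro smooth_funI Ck_on_local)
  fix V \<psi> k y assume chart': "(V, \<psi>) \<in> A" and y: "y \<in> \<psi> ` V"
  let ?\<iota> = "inv_into V \<psi>"
  have \<iota>: "?\<iota> (\<psi> q) = q" if "q \<in> V" for q
    using that chart_inj[OF chart'] by simp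
  from y obtain q where q: "q \<in> V" "y = \<psi> q" by auto
  show "\<exists>T. open T \<and> y \<in> T \<and> Ck_on k T (\<lambda>x. ?Z (?\<iota> x))"
  proof (cases "q \<in> U \<and> \<phi> q \<in> G")
    case True
    let ?W = "V \<inter> (U \<inter> \<phi> -` G)"
    have "open ?W"
      by (intro open_Int[OF chart_open[OF chart']] continuous_open_preimage[OF _ _ G(1)]
          chart_continuous[OF chart] chart_open[OF chart])
    then have T: "open (\<psi> ` ?W)"
      using chart_open_image[OF chart'] by blast
    have "Ck_on k (\<psi> ` ?W) (\<lambda>x. h ((\<phi> \<circ> ?\<iota>) x))"
    proof (rule Ck_on_compose[OF T G(1)])
      show "Ck_on k (\<psi> ` ?W) (\<phi> \<circ> ?\<iota>)"
        by (rule Ck_on_subset[OF chart_transition[OF chart' chart]]) auto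
    qed (use h \<iota> in \<open>auto simp: smooth_on_def\<close>)
    moreover have "?Z (?\<iota> x) = h ((\<phi> \<circ> ?\<iota>) x)" if "x \<in> \<psi> ` ?W" for x
      using that \<iota> by auto
    ultimately have "Ck_on k (\<psi> ` ?W) (\<lambda>x. ?Z (?\<iota> x))"
      by (rule Ck_on_transform[OF T])
    with T True q show ?thesis
      by (intro exI[of _ "\<psi> ` ?W"]) auto
  next
    case False
    let ?C = "inv_into U \<phi> ` K"
    \<comment> \<open>Being compact, the copy of \<open>K\<close> is closed in the whole Hausdorff
      space and not merely in \<open>U\<close>; this settles the boundary points of
      \<open>U\<close>.\<close>
    have "closed ?C"
      using K G by (intro compact_imp_closed compact_continuous_image
          continuous_on_subset[OF chart_inv_continuous[OF chart]]) auto
    then have "open (V - ?C)"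
      using chart_open[OF chart'] by blast
    then have T: "open (\<psi> ` (V - ?C))"
      using chart_open_image[OF chart'] by blast
    have "?Z (?\<iota> x) = 0" if "x \<in> \<psi> ` (V - ?C)" for x
    proof -
      from that obtain q' where q': "q' \<in> V" "q' \<notin> ?C" "x = \<psi> q'" by auto
      have "\<phi> q' \<notin> K" if "q' \<in> U"
        using q'(2) that chart_inj[OF chart] by (metis image_eqI inv_into_f_f)
      with q' h(2) show ?thesis by (simp add: \<iota>)
    qed
    then have "Ck_on k (\<psi> ` (V - ?C)) (\<lambda>x. ?Z (?\<iota> x))"
      by (rule Ck_on_transform[OF T Ck_on_const[OF T]])
    moreover have "q \<notin> ?C"
    proof
      assume "q \<in> ?C"
      then obtain x where x: "x \<in> K" "q = inv_into U \<phi> x" by auto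
      with K G have "x \<in> \<phi> ` U" by auto
      with x K False show False
        by (metis f_inv_into_f inv_into_into subsetD)
    qed
    ultimately show ?thesis
      using T q by (intro exI[of _ "\<psi> ` (V - ?C)"]) auto
  qed
qed

section \<open>Tangent vectors as point derivations\<close>

lemma
  assumes "v \<in> tangent_space A p"
  shows tangent_add: "smooth_fun A f \<Longrightarrow> smooth_fun A g \<Longrightarrow> v (\<lambda>x. f x + g x) = v f + v g"
    and tangent_scale: "smooth_fun A f \<Longrightarrow> v (\<lambda>x. c * f x) = c * v f"
    and tangent_mult: "smooth_fun A f \<Longrightarrow> smooth_fun A g \<Longrightarrow>
      v (\<lambda>x. f x * g x) = f p * v g + g p * v f"
    and tangent_nonsmooth: "\<not> smooth_fun A f \<Longrightarrow> v f = 0"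
  using assms by (auto simp: tangent_space_def)

lemma tangent_zero: "v \<in> tangent_space A p \<Longrightarrow> v (\<lambda>x. 0) = 0"
  using tangent_scale[OF _ smooth_fun_const, of v p 0 0] by simp

lemma tangent_sum:
  assumes "v \<in> tangent_space A p" "\<And>i. i \<in> I \<Longrightarrow> smooth_fun A (f i)"
  shows "v (\<lambda>x. \<Sum>i\<in>I. f i x) = (\<Sum>i\<in>I. v (f i))"
  using assms(2)
  by (induction I rule: infinite_finite_induct)
     (auto simp: tangent_zero[OF assms(1)] tangent_add[OF assms(1)] smooth_fun_sum)

text \<open>Multiplying by the square of a bump function \<open>b\<close> makes all factors in Hadamard's formula
  global functions, so that no bump function with a plateau is needed.\<close>

lemma tangent_space_subset_span:
  "\<exists>B. finite B \<and> card B \<le> CARD('n) \<and> tangent_space A p \<subseteq> span B"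
proof -
  obtain U \<phi> where chart: "(U, \<phi>) \<in> A" and p: "p \<in> U"
    using chart_cover .
  let ?\<iota> = "inv_into U \<phi>"
  define a where "a = \<phi> p"
  have \<iota>: "?\<iota> (\<phi> q) = q" if "q \<in> U" for q
    using that chart_inj[OF chart] by simp
  obtain R where R: "0 < R" "ball a R \<subseteq> \<phi> ` U"
    using chart_range_open[OF chart] p unfolding a_def open_contains_ball by blast
  \<comment> \<open>With half the radius, the closed ball outside which \<open>b\<close> vanishes is
    a compact subset of the open ball on which Hadamard's formula is used.\<close>
  obtain b :: "real ^ 'n \<Rightarrow> real" where b: "smooth_on UNIV b" "b a \<noteq> 0"
    "\<And>x. x \<notin> ball a (R / 2) \<Longrightarrow> b x = 0"
    using bump_exists[of "R / 2" a] R by auto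
  have b_out: "b x = 0" if "x \<notin> cball a (R / 2)" for x
    using b(3) that by force
  define Z where "Z h q = (if q \<in> U then b (\<phi> q) * h (\<phi> q) else 0)" for h q
  have Z: "smooth_fun A (Z h)" if "smooth_on (ball a R) h" for h
  proof -
    have "smooth_fun A (\<lambda>q. if q \<in> U then (\<lambda>x. b x * h x) (\<phi> q) else 0)"
    proof (rule smooth_fun_extend_zero[OF chart open_ball R(2)])
      show "cball a (R / 2) \<subseteq> ball a R" using R by auto
      show "smooth_on (ball a R) (\<lambda>x. b x * h x)"
        using b(1) that Ck_on_subset[of _ UNIV b "ball a R"]
        by (auto simp: smooth_on_def intro: Ck_on_mult)
    qed (use b_out in auto)
    then show ?thesis by (simp add: Z_def[abs_def])
  qed
  \<comment> \<open>The coordinate derivations at \<open>p\<close>. The value 0 on non-smooth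
    functions matches the normalization of tangent vectors, so that \<open>rep\<close> can hold as
    an equality of total functions.\<close>
  define d where "d i f = (if smooth_fun A f then frechet_derivative (\<lambda>x. f (?\<iota> x)) (at a) i else 0)"
    for i f
  have rep: "v = (\<Sum>i\<in>Basis. (v (Z (\<lambda>x. (x - a) \<bullet> i)) / b a) *\<^sub>R d i)" if v: "v \<in> tangent_space A p" for v
  proof
    fix f
    show "v f = (\<Sum>i\<in>Basis. (v (Z (\<lambda>x. (x - a) \<bullet> i)) / b a) *\<^sub>R d i) f"
    proof (cases "smooth_fun A f")
      case f: True
      have "smooth_on (ball a R) (\<lambda>x. f (?\<iota> x))"
        using Ck_on_subset[OF smooth_fun_Ck_on[OF f chart] R(2)] by (simp add: smooth_on_def)
      then obtain g where g: "\<And>i. i \<in> Basis \<Longrightarrow> smooth_on (ball a R) (g i)"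
        "\<And>i. i \<in> Basis \<Longrightarrow> g i a = d i f"
        "\<And>x. x \<in> ball a R \<Longrightarrow> f (?\<iota> x) = f (?\<iota> a) + (\<Sum>i\<in>Basis. ((x - a) \<bullet> i) * g i x)"
        using hadamard[OF _ R(1)] f by (auto simp: d_def)
      have lin: "smooth_on (ball a R) (\<lambda>x. (x - a) \<bullet> i)" for i
        unfolding smooth_on_def inner_diff_left diff_conv_add_uminus
        by (intro allI Ck_on_add Ck_on_const open_ball
            Ck_on_bounded_linear[OF open_ball bounded_linear_inner_left] Ck_on_id)
      let ?b = "Z (\<lambda>x. 1)"
      have b': "smooth_fun A ?b"
        by (intro Z) (simp add: smooth_on_def Ck_on_const)
      have \<iota>a: "?\<iota> a = p"
        using p by (simp add: a_def \<iota>)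
      have id: "(\<lambda>q. (?b q * ?b q) * f q) =
          (\<lambda>q. f p * (?b q * ?b q) + (\<Sum>i\<in>Basis. Z (\<lambda>x. (x - a) \<bullet> i) q * Z (g i) q))"
      proof
        fix q
        show "(?b q * ?b q) * f q =
          f p * (?b q * ?b q) + (\<Sum>i\<in>Basis. Z (\<lambda>x. (x - a) \<bullet> i) q * Z (g i) q)"
        proof (cases "q \<in> U \<and> \<phi> q \<in> ball a R")
          case True
          then have "f q = f p + (\<Sum>i\<in>Basis. ((\<phi> q - a) \<bullet> i) * g i (\<phi> q))"
            using g(3)[of "\<phi> q"] by (simp add: \<iota> \<iota>a)
          with True show ?thesis
            by (simp add: Z_def sum_distrib_left algebra_simps)
        next
          case False
          then have "q \<notin> U \<or> b (\<phi> q) = 0"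
            using b(3)[of "\<phi> q"] R(1) by auto
          then show ?thesis by (auto simp: Z_def)
        qed
      qed
      have smooth: "smooth_fun A (\<lambda>q. ?b q * ?b q)"
        "\<And>i. i \<in> Basis \<Longrightarrow> smooth_fun A (\<lambda>q. Z (\<lambda>x. (x - a) \<bullet> i) q * Z (g i) q)"
        by (auto intro!: smooth_fun_mult b' Z lin g)
      have "v (\<lambda>q. (?b q * ?b q) * f q) = (b a * b a) * v f + f p * v (\<lambda>q. ?b q * ?b q)"
        using tangent_mult[OF v smooth(1) f] p by (simp add: Z_def a_def)
      moreover have "v (\<lambda>q. f p * (?b q * ?b q) + (\<Sum>i\<in>Basis. Z (\<lambda>x. (x - a) \<bullet> i) q * Z (g i) q)) =
          f p * v (\<lambda>q. ?b q * ?b q) + (\<Sum>i\<in>Basis. v (\<lambda>q. Z (\<lambda>x. (x - a) \<bullet> i) q * Z (g i) q))"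
        using smooth
        by (subst tangent_add[OF v])
           (auto simp: tangent_scale[OF v] tangent_sum[OF v]
             intro: smooth_fun_sum smooth_fun_mult smooth_fun_const)
      \<comment> \<open>The factor \<open>x - a\<close> vanishes at \<open>a\<close>, so of the
        product rule only the term with \<open>g i a\<close> survives. The terms with
        \<open>f p\<close> occur on both sides and cancel.\<close>
      moreover have "v (\<lambda>q. Z (\<lambda>x. (x - a) \<bullet> i) q * Z (g i) q) = b a * d i f * v (Z (\<lambda>x. (x - a) \<bullet> i))"
        if "i \<in> Basis" for i
        using tangent_mult[OF v Z[OF lin] Z[OF g(1)[OF that]]] p g(2)[OF that]
        by (simp add: Z_def a_def)
      ultimately have "(b a * b a) * v f = (\<Sum>i\<in>Basis. b a * d i f * v (Z (\<lambda>x. (x - a) \<bullet> i)))"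
        unfolding id by simp
      also have "\<dots> = (b a * b a) * (\<Sum>i\<in>Basis. v (Z (\<lambda>x. (x - a) \<bullet> i)) / b a * d i f)"
        using b(2) by (simp add: sum_distrib_left field_simps)
      finally show ?thesis
        using b(2) by (simp add: sum_fun_apply scaleR_fun_def)
    next
      case False
      then show ?thesis
        by (simp add: tangent_nonsmooth[OF v] sum_fun_apply scaleR_fun_def d_def)
    qed
  qed
  have "v \<in> span (d ` Basis)" if "v \<in> tangent_space A p" for v
    by (subst rep[OF that]) (intro span_sum span_scale span_base imageI)
  moreover have "card (d ` Basis) \<le> CARD('n)"
    using card_image_le[of Basis d] by simp
  ultimately show ?thesis
    by (intro exI[of _ "d ` Basis"]) auto
qed

end

section \<open>Frames\<close>

text \<open>A basis chosen among the vectors \<open>e k\<close> has \<open>n\<close> elements, but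
  there are at most \<open>n\<close> such vectors; hence all of them are used and none is repeated.
  This turns the dimension conditions into linear independence.\<close>

lemma dim_card_imp_basis:
  fixes e :: "nat \<Rightarrow> 'v::real_vector"
  assumes "dim (span (e ` {..<n})) = n"
  shows "inj_on e {..<n}" and "independent (e ` {..<n})"
proof -
  obtain B where B: "B \<subseteq> e ` {..<n}" "independent B" "e ` {..<n} \<subseteq> span B"
      "card B = dim (e ` {..<n})"
    using basis_exists .
  have "card (e ` {..<n}) \<le> card B"
    using card_image_le[of "{..<n}" e] assms B(4) by simp
  then have eq: "B = e ` {..<n}"
    by (intro card_seteq B(1)) auto
  with B show "independent (e ` {..<n})" by simp
  from eq B(4) assms show "inj_on e {..<n}"
    by (intro eq_card_imp_inj_on) auto
qed

lemma dim_card_imp_zero: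
  fixes e :: "nat \<Rightarrow> 'v::real_vector"
  assumes "dim (span (e ` {..<n})) = n" and "(\<Sum>k<n. c k *\<^sub>R e k) = 0" and "k < n"
  shows "c k = 0"
proof -
  note e = dim_card_imp_basis[OF assms(1)]
  let ?u = "\<lambda>v. c (inv_into {..<n} e v)"
  have "(\<Sum>v\<in>e ` {..<n}. ?u v *\<^sub>R v) = 0"
    using assms(2) e(1) by (simp add: sum.reindex)
  from independentD[OF e(2) _ _ this, of "e k"] show ?thesis
    using assms(3) e(1) by simp
qed

lemma span_image_sum:
  assumes "finite I" "w \<in> span (e ` I)"
  obtains c where "w = (\<Sum>k\<in>I. c k *\<^sub>R e k)"
proof -
  have "\<exists>c. w = (\<Sum>k\<in>I. c k *\<^sub>R e k)"
    using assms(2)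
  proof (induction rule: span_induct_alt)
    case base
    show ?case by (rule exI[of _ "\<lambda>_. 0"]) simp
  next
    case (step r x y)
    then obtain k c where k: "k \<in> I" "x = e k" and "y = (\<Sum>k\<in>I. c k *\<^sub>R e k)" by auto
    then have "r *\<^sub>R x + y = (\<Sum>j\<in>I. ((if j = k then r else 0) + c j) *\<^sub>R e j)"
      using assms(1) by (simp add: scaleR_add_left sum.distrib if_distrib[of "\<lambda>a. a *\<^sub>R _"] cong: if_cong)
    then show ?case by (rule exI[of _ "\<lambda>j. (if j = k then r else 0) + c j"])
  qed
  then show ?thesis using that by blast
qed

context atlas
begin

text \<open>A tangent vector outside the span would give \<open>CARD('n) + 1\<close> independent
  vectors in a space of dimension at most \<open>CARD('n)\<close>.\<close>

lemma tangent_in_span: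
  assumes "dim (span (e ` {..<CARD('n)})) = CARD('n)"
    and "\<And>k. k < CARD('n) \<Longrightarrow> e k \<in> tangent_space A p" and "w \<in> tangent_space A p"
  shows "w \<in> span (e ` {..<CARD('n)})"
proof (rule ccontr)
  assume w: "w \<notin> span (e ` {..<CARD('n)})"
  note e = dim_card_imp_basis[OF assms(1)]
  obtain B where B: "finite B" "card B \<le> CARD('n)" "tangent_space A p \<subseteq> span B"
    using tangent_space_subset_span by blast
  have "independent (insert w (e ` {..<CARD('n)}))"
    using e(2) w by (simp add: independent_insert span_base)
  moreover have "insert w (e ` {..<CARD('n)}) \<subseteq> span B"
    using assms(2,3) B(3) by auto
  ultimately have "card (insert w (e ` {..<CARD('n)})) \<le> card B"
    using independent_span_bound[OF B(1)] by blast
  moreover have "card (insert w (e ` {..<CARD('n)})) = Suc (CARD('n))"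
    using e(1) w by (subst card_insert_disjoint) (auto simp: card_image span_base)
  ultimately show False using B(2) by simp
qed

text \<open>The value vectors of the \<open>e j\<close> on smooth functions span
  \<open>real ^ 'n\<close>, since a vector orthogonal to all of them holds the coefficients of a
  linear relation between the \<open>e j\<close>. A basis among them provides the rows of an
  invertible matrix.\<close>

lemma tangent_frame_det:
  fixes e :: "'n \<Rightarrow> 'm tangent"
  assumes "\<And>i. e i \<in> tangent_space A p"
    and indep: "\<And>c. (\<Sum>i\<in>UNIV. c i *\<^sub>R e i) = 0 \<Longrightarrow> \<forall>i. c i = 0"
  obtains g :: "'n \<Rightarrow> 'm \<Rightarrow> real" where "\<And>i. smooth_fun A (g i)" "det (\<chi> i j. e j (g i)) \<noteq> 0"
proof -
  define S :: "(real ^ 'n) set" where "S = {\<chi> j. e j g | g. smooth_fun A g}"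
  have "span S = UNIV"
  proof (rule ccontr)
    assume "span S \<noteq> UNIV"
    then obtain a where a: "a \<noteq> 0" "\<And>x. x \<in> span S \<Longrightarrow> a \<bullet> x = 0"
      using span_not_UNIV_orthogonal by blast
    have "(\<Sum>i\<in>UNIV. a $ i *\<^sub>R e i) g = 0" for g
    proof (cases "smooth_fun A g")
      case True
      then have "a \<bullet> (\<chi> j. e j g) = 0"
        by (intro a(2) span_base) (auto simp: S_def)
      then show ?thesis
        by (simp add: inner_vec_def sum_fun_apply scaleR_fun_def)
    next
      case False
      then show ?thesis
        by (simp add: tangent_nonsmooth[OF assms(1)] sum_fun_apply scaleR_fun_def)
    qed
    then have "(\<Sum>i\<in>UNIV. a $ i *\<^sub>R e i) = 0"
      by (simp add: fun_eq_iff)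
    with indep[of "\<lambda>i. a $ i"] a(1) show False
      by (simp add: vec_eq_iff)
  qed
  obtain B where B: "B \<subseteq> S" "independent B" "S \<subseteq> span B" "card B = dim S"
    using basis_exists .
  from \<open>span S = UNIV\<close> B(3) have spanB: "span B = UNIV"
    by (metis span_minimal subspace_span top.extremum_uniqueI)
  have "card B = CARD('n)"
    using B(4) \<open>span S = UNIV\<close> by (metis DIM_cart DIM_real dim_UNIV dim_span mult.right_neutral)
  moreover have "finite B"
    using B(2) by (rule independent_imp_finite)
  ultimately obtain r where r: "bij_betw r (UNIV :: 'n set) B"
    using finite_same_card_bij[of "UNIV :: 'n set" B] by auto
  have "\<exists>g. smooth_fun A g \<and> r i = (\<chi> j. e j g)" for i
    using r B(1) unfolding bij_betw_def S_def by blast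
  then obtain g where g: "\<And>i. smooth_fun A (g i)" "\<And>i. r i = (\<chi> j. e j (g i))"
    by metis
  let ?M = "\<chi> i j. e j (g i)"
  have "row i ?M = r i" for i
    by (simp add: row_def g(2))
  then have "rows ?M = B"
    using r by (auto simp: rows_def bij_betw_def)
  then have "\<exists>N. N ** ?M = mat 1"
    using spanB matrix_left_invertible_span_rows[of ?M] by metis
  then have "det ?M \<noteq> 0"
    by (simp add: invertible_left_inverse[symmetric] invertible_det_nz)
  with g(1) show thesis by (rule that)
qed

lemma smooth_fun_det:
  fixes M :: "'m \<Rightarrow> real ^ 'k ^ 'k"
  assumes "\<And>i j. smooth_fun A (\<lambda>p. M p $ i $ j)"
  shows "smooth_fun A (\<lambda>p. det (M p))"
  unfolding det_def
  by (intro smooth_fun_sum smooth_fun_mult smooth_fun_prod smooth_fun_const assms)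

lemma
  assumes "vector_field A X"
  shows vfield_tangent: "X p \<in> tangent_space A p"
    and vfield_smooth: "smooth_fun A f \<Longrightarrow> smooth_fun A (\<lambda>p. X p f)"
  using assms by (auto simp: vector_field_def)

text \<open>Cramer's rule, applied to the derivatives of finitely many suitable functions, exhibits the
  coefficients as local quotients of smooth functions.\<close>

lemma smooth_frame_coeffs:
  fixes e :: "'n \<Rightarrow> 'm vfield"
  assumes e: "\<And>i. vector_field A (e i)" and X: "vector_field A X"
    and indep: "\<And>p c. (\<Sum>i\<in>UNIV. c i *\<^sub>R e i p) = 0 \<Longrightarrow> \<forall>i. c i = 0"
    and c: "\<And>p. X p = (\<Sum>i\<in>UNIV. c i p *\<^sub>R e i p)"
  shows "smooth_fun A (c k)"
proof (rule smooth_fun_local_quotient)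
  fix p
  obtain g :: "'n \<Rightarrow> 'm \<Rightarrow> real" where g: "\<And>i. smooth_fun A (g i)" "det (\<chi> i j. e j p (g i)) \<noteq> 0"
    by (rule tangent_frame_det[of "\<lambda>i. e i p" p, OF vfield_tangent[OF e] indep[where p = p]],
        assumption, rule that)
  let ?M = "\<lambda>q. \<chi> i j. e j q (g i)"
  let ?N = "\<lambda>q. \<chi> i j. if j = k then X q (g i) else e j q (g i)"
  have "det (?M q) * c k q = det (?N q)" for q
  proof -
    have "?M q *v (\<chi> i. c i q) = (\<chi> i. X q (g i))"
      by (simp add: c matrix_vector_mult_def vec_eq_iff sum_fun_apply scaleR_fun_def mult.commute)
    with cramer_lemma[of k "?M q" "\<chi> i. c i q"] show ?thesis
      by (simp add: mult.commute cong: if_cong)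
  qed
  moreover have "smooth_fun A (\<lambda>q. det (?M q))"
    by (intro smooth_fun_det) (simp add: vfield_smooth e g)
  moreover have "smooth_fun A (\<lambda>q. det (?N q))"
  proof (intro smooth_fun_det)
    show "smooth_fun A (\<lambda>q. ?N q $ i $ j)" for i j
      by (cases "j = k") (simp_all add: vfield_smooth e g X)
  qed
  ultimately show "\<exists>N D. smooth_fun A N \<and> smooth_fun A D \<and> D p \<noteq> 0 \<and> (\<forall>q. D q * c k q = N q)"
    using g(2) by blast
qed

text \<open>Cramer's rule needs matrices indexed by the type \<open>'n\<close>, whereas the frames
  below are indexed by numbers; a bijection \<open>h\<close> carries the pointwise coefficients over
  and their smoothness back.\<close>

lemma frame_decomposition:
  assumes e: "\<And>k. k < CARD('n) \<Longrightarrow> vector_field A (e k)" and X: "vector_field A X"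
    and dim: "\<And>p. dim (span ((\<lambda>k. e k p) ` {..<CARD('n)})) = CARD('n)"
  obtains c where "\<And>k. k < CARD('n) \<Longrightarrow> smooth_fun A (c k)"
    and "\<And>p. X p = (\<Sum>k<CARD('n). c k p *\<^sub>R e k p)"
proof -
  have "\<exists>c. X p = (\<Sum>k<CARD('n). c k *\<^sub>R e k p)" for p
    using span_image_sum[OF finite_lessThan
        tangent_in_span[OF dim vfield_tangent[OF e] vfield_tangent[OF X]]] by blast
  then obtain c where c: "\<And>p. X p = (\<Sum>k<CARD('n). c p k *\<^sub>R e k p)"
    by metis
  obtain h where h: "bij_betw h (UNIV :: 'n set) {..<CARD('n)}"
    using finite_same_card_bij[of "UNIV :: 'n set" "{..<CARD('n)}"] by auto
  have reindex: "(\<Sum>i\<in>UNIV. u (h i) *\<^sub>R e (h i) p) = (\<Sum>k<CARD('n). u k *\<^sub>R e k p)" for u p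
    by (rule sum.reindex_bij_betw[OF h])
  have hk: "h i < CARD('n)" for i
    using h by (auto simp: bij_betw_def)
  have "smooth_fun A ((\<lambda>i p. c p (h i)) i)" for i
  proof (rule smooth_frame_coeffs)
    show "vector_field A (e (h i))" for i
      by (rule e[OF hk])
    show "X p = (\<Sum>i\<in>UNIV. c p (h i) *\<^sub>R e (h i) p)" for p
      by (simp add: reindex c)
    show "\<forall>i. u i = 0" if "(\<Sum>i\<in>UNIV. u i *\<^sub>R e (h i) p) = 0" for p u
    proof
      fix i
      have inv: "inv_into UNIV h (h j) = j" for j
        using h by (simp add: bij_betw_def)
      have "(\<Sum>k<CARD('n). u (inv_into UNIV h k) *\<^sub>R e k p) = 0"
        using that reindex[of "\<lambda>k. u (inv_into UNIV h k)" p] by (simp add: inv)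
      from dim_card_imp_zero[OF dim this hk[of i]] show "u i = 0"
        by (simp add: inv)
    qed
  qed (rule X)
  then have "smooth_fun A (\<lambda>p. c p k)" if "k < CARD('n)" for k
    using h that by (metis bij_betw_imp_surj_on imageE lessThan_iff)
  with c show thesis by (intro that[of "\<lambda>k p. c p k"])
qed

end

section \<open>Lie brackets and modules of vector fields\<close>

lemma vfield_add_apply: "(X + Y) p f = X p f + Y p f" for X Y :: "'m vfield"
  by (simp add: plus_fun_def)

lemma fscale_apply: "(g \<cdot> X) p f = g p * X p f"
  by (simp add: fscale_def scaleR_fun_def)

lemma fscale_at: "(g \<cdot> X) p = g p *\<^sub>R X p"
  by (simp add: fscale_def)

lemma fscale_const_one: "(\<lambda>p. 1) \<cdot> X = X"
  by (simp add: fun_eq_iff fscale_apply)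

lemma fscale_fscale: "f \<cdot> (g \<cdot> X) = (\<lambda>p. f p * g p) \<cdot> X"
  by (simp add: fun_eq_iff fscale_apply)

lemmas vfield_simps = fun_eq_iff vfield_add_apply fscale_apply

lemma ad_pow_0 [simp]: "ad_pow X 0 Y = Y"
  and ad_pow_Suc [simp]: "ad_pow X (Suc k) Y = lie_bracket X (ad_pow X k Y)"
  by (simp_all add: ad_pow_def)

lemma bracket_self: "lie_bracket X X = 0"
  by (simp add: lie_bracket_def fun_eq_iff)

text \<open>The sign is written as a constant function, so that the rules for \<open>\<cdot>\<close>
  cover it.\<close>

lemma bracket_swap: "lie_bracket X Y = (\<lambda>p. - 1) \<cdot> lie_bracket Y X"
  by (simp add: vfield_simps lie_bracket_def)

context atlas
begin

section \<open>Derivation rules for vector fields\<close>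

lemma vfield_nonsmooth: "vector_field A X \<Longrightarrow> \<not> smooth_fun A f \<Longrightarrow> X p f = 0"
  using tangent_nonsmooth vfield_tangent by blast

lemma vfield_zero: "vector_field A 0"
  by (simp add: vector_field_def tangent_space_def smooth_fun_const)

lemma vfield_add: "vector_field A X \<Longrightarrow> vector_field A Y \<Longrightarrow> vector_field A (X + Y)"
  by (auto simp: vector_field_def tangent_space_def algebra_simps smooth_fun_add)

lemma vfield_fscale: "smooth_fun A g \<Longrightarrow> vector_field A X \<Longrightarrow> vector_field A (g \<cdot> X)"
  by (auto simp: vector_field_def tangent_space_def fscale_apply algebra_simps smooth_fun_mult)

text \<open>Applying \<open>X\<close> after \<open>Y\<close> to a product \<open>f g\<close> gives
  the mixed terms \<open>X f * Y g + X g * Y f\<close>. Their sum is symmetric in \<open>X\<close>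
  and \<open>Y\<close> and cancels in the commutator, which leaves the product rule.\<close>

lemma vfield_bracket:
  assumes X: "vector_field A X" and Y: "vector_field A Y"
  shows "vector_field A (lie_bracket X Y)"
  unfolding vector_field_def
proof (intro conjI allI impI)
  note Xt = vfield_tangent[OF X] and Yt = vfield_tangent[OF Y]
  note Xs = vfield_smooth[OF X] and Ys = vfield_smooth[OF Y]
  show "smooth_fun A (\<lambda>p. lie_bracket X Y p f)" if "smooth_fun A f" for f
    using that by (auto simp: lie_bracket_def intro!: smooth_fun_diff Xs Ys)
  show "lie_bracket X Y p \<in> tangent_space A p" for p
    unfolding tangent_space_def mem_Collect_eq
  proof (intro conjI allI impI)
    fix f g assume f: "smooth_fun A f" and g: "smooth_fun A g"
    show "lie_bracket X Y p (\<lambda>x. f x + g x) = lie_bracket X Y p f + lie_bracket X Y p g"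
      by (simp add: lie_bracket_def tangent_add[OF Xt] tangent_add[OF Yt] Xs Ys f g)
    show "lie_bracket X Y p (\<lambda>x. f x * g x) = f p * lie_bracket X Y p g + g p * lie_bracket X Y p f"
      by (simp add: lie_bracket_def tangent_mult[OF Xt] tangent_mult[OF Yt] tangent_add[OF Xt]
          tangent_add[OF Yt] Xs Ys f g smooth_fun_mult algebra_simps)
  next
    fix f c assume f: "smooth_fun A f"
    show "lie_bracket X Y p (\<lambda>x. c * f x) = c * lie_bracket X Y p f"
      by (simp add: lie_bracket_def tangent_scale[OF Xt] tangent_scale[OF Yt] Xs Ys f algebra_simps)
  next
    fix f assume "\<not> smooth_fun A f"
    then show "lie_bracket X Y p f = 0"
      by (simp add: lie_bracket_def vfield_nonsmooth X Y tangent_zero[OF Xt] tangent_zero[OF Yt])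
  qed
qed

lemma vfield_ad_pow: "vector_field A X \<Longrightarrow> vector_field A Y \<Longrightarrow> vector_field A (ad_pow X k Y)"
  by (induction k) (auto intro: vfield_bracket)

lemma vfield_eqI:
  assumes "vector_field A X" "vector_field A Y" "\<And>p f. smooth_fun A f \<Longrightarrow> X p f = Y p f"
  shows "X = Y"
proof (intro ext)
  show "X p f = Y p f" for p f
    by (cases "smooth_fun A f") (simp_all add: assms vfield_nonsmooth[OF assms(1)] vfield_nonsmooth[OF assms(2)])
qed

lemma bracket_add_right:
  assumes "vector_field A X" "vector_field A Y" "vector_field A Z"
  shows "lie_bracket X (Y + Z) = lie_bracket X Y + lie_bracket X Z"
proof (rule vfield_eqI)
  show "lie_bracket X (Y + Z) p f = (lie_bracket X Y + lie_bracket X Z) p f" if "smooth_fun A f" for p f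
    using tangent_add[OF vfield_tangent[OF assms(1)], of "\<lambda>q. Y q f" "\<lambda>q. Z q f" p] that
    by (simp add: lie_bracket_def vfield_add_apply vfield_smooth assms)
qed (intro vfield_bracket vfield_add assms)+

lemma bracket_add_left:
  assumes "vector_field A X" "vector_field A Y" "vector_field A Z"
  shows "lie_bracket (X + Y) Z = lie_bracket X Z + lie_bracket Y Z"
  unfolding bracket_swap[of "X + Y" Z] bracket_swap[of X Z] bracket_swap[of Y Z]
    bracket_add_right[OF assms(3,1,2)]
  by (simp add: vfield_simps)

lemma bracket_fscale_right:
  assumes "vector_field A X" "vector_field A Y" "smooth_fun A g"
  shows "lie_bracket X (g \<cdot> Y) = (\<lambda>p. X p g) \<cdot> Y + g \<cdot> lie_bracket X Y"
proof (rule vfield_eqI)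
  show "lie_bracket X (g \<cdot> Y) p f = ((\<lambda>p. X p g) \<cdot> Y + g \<cdot> lie_bracket X Y) p f"
    if "smooth_fun A f" for p f
    using tangent_mult[OF vfield_tangent[OF assms(1)] assms(3), of "\<lambda>q. Y q f" p] that
    by (simp add: lie_bracket_def vfield_add_apply fscale_apply vfield_smooth assms algebra_simps)
qed (intro vfield_bracket vfield_add vfield_fscale vfield_smooth[OF assms(1)] assms)+

lemma bracket_fscale_left:
  assumes "vector_field A X" "vector_field A Y" "smooth_fun A g"
  shows "lie_bracket (g \<cdot> X) Y = (\<lambda>p. - Y p g) \<cdot> X + g \<cdot> lie_bracket X Y"
  unfolding bracket_swap[of "g \<cdot> X" Y] bracket_swap[of X Y] bracket_fscale_right[OF assms(2,1,3)]
  by (simp add: vfield_simps)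

text \<open>The submodule over the smooth functions generated by \<open>S\<close>. Computing modulo
  such a submodule allows coefficients of no interest to stay undetermined.\<close>

inductive_set smooth_module :: "'m vfield set \<Rightarrow> 'm vfield set" for S where
  zero: "0 \<in> smooth_module S"
| base: "X \<in> S \<Longrightarrow> X \<in> smooth_module S"
| add: "X \<in> smooth_module S \<Longrightarrow> Y \<in> smooth_module S \<Longrightarrow> X + Y \<in> smooth_module S"
| fscale: "smooth_fun A g \<Longrightarrow> X \<in> smooth_module S \<Longrightarrow> g \<cdot> X \<in> smooth_module S"

lemma smooth_module_vfield:
  assumes "X \<in> smooth_module S" "\<And>X. X \<in> S \<Longrightarrow> vector_field A X"
  shows "vector_field A X"
  using assms by induction (auto intro: vfield_zero vfield_add vfield_fscale)

lemma smooth_module_minimal: "S \<subseteq> smooth_module T \<Longrightarrow> smooth_module S \<subseteq> smooth_module T"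
proof
  fix X assume "X \<in> smooth_module S" "S \<subseteq> smooth_module T"
  then show "X \<in> smooth_module T"
    by induction (auto intro: smooth_module.intros)
qed

lemma smooth_module_at: "X \<in> smooth_module S \<Longrightarrow> X p \<in> span ((\<lambda>Y. Y p) ` S)"
proof (induction rule: smooth_module.induct)
  case zero
  show ?case
    using span_zero[of "(\<lambda>Y. Y p) ` S"] by (simp add: zero_fun_def)
next
  case (base X)
  then show ?case by (simp add: span_base)
next
  case (add X Y)
  then show ?case
    using span_add[of "X p" _ "Y p"] by (simp add: plus_fun_def)
next
  case (fscale g X)
  then show ?case by (simp add: fscale_at span_scale)
qed

text \<open>Since \<open>[X, g Y] = X(g) Y + g [X, Y]\<close>, it is enough to treat generators,
  provided the target module also contains the generators themselves, which absorb the first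
  term.\<close>

lemma bracket_smooth_module:
  assumes X: "vector_field A X" and S: "\<And>Y. Y \<in> S \<Longrightarrow> vector_field A Y"
    and "S \<subseteq> smooth_module T" and "\<And>Y. Y \<in> S \<Longrightarrow> lie_bracket X Y \<in> smooth_module T"
    and "Z \<in> smooth_module S"
  shows "lie_bracket X Z \<in> smooth_module T"
  using assms(5)
proof induction
  case zero
  have "lie_bracket X 0 = 0"
    by (simp add: lie_bracket_def fun_eq_iff tangent_zero[OF vfield_tangent[OF X]])
  then show ?case by (simp only: smooth_module.zero)
next
  case (base Y)
  then show ?case by (rule assms(4))
next
  case (add Y Z)
  have YZ: "vector_field A Y" "vector_field A Z"
    using add.hyps by (auto intro: smooth_module_vfield S)
  show ?case
    unfolding bracket_add_right[OF X YZ] using add.IH by (rule smooth_module.add)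
next
  case (fscale g Y)
  have Y: "vector_field A Y"
    using fscale.hyps(2) by (auto intro: smooth_module_vfield S)
  have "Y \<in> smooth_module T"
    using fscale.hyps(2) smooth_module_minimal[OF assms(3)] by blast
  then show ?case
    unfolding bracket_fscale_right[OF X Y fscale.hyps(1)]
    by (intro smooth_module.add smooth_module.fscale vfield_smooth[OF X] fscale.hyps fscale.IH)
qed

text \<open>The exponent 0 is left out, so that the coefficient of the drift \<open>g0\<close> can
  still be compared modulo these generators.\<close>

definition ad_gens :: "'m vfield \<Rightarrow> 'm vfield \<Rightarrow> nat \<Rightarrow> 'm vfield set" where
  "ad_gens g0 g1 k = insert g1 ((\<lambda>j. ad_pow g1 j g0) ` {1..k})"

lemma ad_gens_vfield:
  "vector_field A g0 \<Longrightarrow> vector_field A g1 \<Longrightarrow> X \<in> ad_gens g0 g1 k \<Longrightarrow> vector_field A X"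
  by (auto simp: ad_gens_def vfield_ad_pow)

lemma smooth_module_ad_gens_mono:
  "j \<le> k \<Longrightarrow> smooth_module (ad_gens g0 g1 j) \<subseteq> smooth_module (ad_gens g0 g1 k)"
  by (rule smooth_module_minimal) (auto simp: ad_gens_def intro: smooth_module.base)

lemma bracket_ad_gens:
  assumes g: "vector_field A g0" "vector_field A g1" and "Z \<in> smooth_module (ad_gens g0 g1 k)"
  shows "lie_bracket g1 Z \<in> smooth_module (ad_gens g0 g1 (Suc k))"
proof (rule bracket_smooth_module[OF g(2) ad_gens_vfield[OF g] _ _ assms(3)])
  show "ad_gens g0 g1 k \<subseteq> smooth_module (ad_gens g0 g1 (Suc k))"
    by (auto simp: ad_gens_def intro: smooth_module.base)
  fix Y assume "Y \<in> ad_gens g0 g1 k"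
  then consider "Y = g1" | j where "1 \<le> j" "j \<le> k" "Y = ad_pow g1 j g0"
    by (auto simp: ad_gens_def)
  then show "lie_bracket g1 Y \<in> smooth_module (ad_gens g0 g1 (Suc k))"
  proof cases
    case 1
    then show ?thesis by (simp add: bracket_self smooth_module.zero)
  next
    case 2
    then have "lie_bracket g1 Y = ad_pow g1 (Suc j) g0" by simp
    moreover have "ad_pow g1 (Suc j) g0 \<in> ad_gens g0 g1 (Suc k)"
      using 2 unfolding ad_gens_def by (intro insertI2 imageI) simp
    ultimately show ?thesis
      by (simp only: smooth_module.base)
  qed
qed

text \<open>By induction on the exponent: the bracket with \<open>\<beta> g1\<close> raises
  \<open>k\<close> by one just as that with \<open>g1\<close> does, because rescaling the left
  argument only adds a multiple of \<open>g1\<close>.\<close>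

lemma smooth_module_feedback:
  assumes g: "vector_field A g0" "vector_field A g1" and \<alpha>: "smooth_fun A \<alpha>" and \<beta>: "smooth_fun A \<beta>"
  shows "smooth_module (ad_gens (g0 + \<alpha> \<cdot> g1) (\<beta> \<cdot> g1) k) \<subseteq> smooth_module (ad_gens g0 g1 k)"
proof -
  let ?g0 = "g0 + \<alpha> \<cdot> g1" and ?g1 = "\<beta> \<cdot> g1"
  have g1: "g1 \<in> smooth_module (ad_gens g0 g1 j)" for j
    by (rule smooth_module.base) (simp add: ad_gens_def)
  have step: "lie_bracket ?g1 Z \<in> smooth_module (ad_gens g0 g1 (Suc j))"
    if "lie_bracket g1 Z \<in> smooth_module (ad_gens g0 g1 (Suc j))" "vector_field A Z" for Z j
    using that
    by (simp add: bracket_fscale_left g \<beta> smooth_module.add smooth_module.fscale g1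
        smooth_fun_minus vfield_smooth)
  have "ad_pow ?g1 (Suc j) ?g0 \<in> smooth_module (ad_gens g0 g1 (Suc j))" for j
  proof (induction j)
    case 0
    have "lie_bracket g1 g0 \<in> smooth_module (ad_gens g0 g1 (Suc 0))"
      by (rule smooth_module.base) (simp add: ad_gens_def)
    moreover have "lie_bracket g1 (\<alpha> \<cdot> g1) \<in> smooth_module (ad_gens g0 g1 (Suc 0))"
      by (intro bracket_ad_gens g smooth_module.fscale \<alpha> g1)
    ultimately have "lie_bracket g1 ?g0 \<in> smooth_module (ad_gens g0 g1 (Suc 0))"
      by (simp add: bracket_add_right g vfield_fscale \<alpha> smooth_module.add)
    then show ?case
      unfolding ad_pow_Suc ad_pow_0 by (intro step vfield_add vfield_fscale g \<alpha>)
  next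
    case (Suc j)
    then show ?case
      using step[OF bracket_ad_gens[OF g Suc] smooth_module_vfield[OF Suc ad_gens_vfield[OF g]]] by simp
  qed
  then have "ad_pow ?g1 j ?g0 \<in> smooth_module (ad_gens g0 g1 k)" if "1 \<le> j" "j \<le> k" for j
    using that smooth_module_ad_gens_mono[OF that(2)] by (cases j) auto
  then show ?thesis
    using smooth_module.fscale[OF \<beta> g1] by (intro smooth_module_minimal) (auto simp: ad_gens_def[of ?g0])
qed

text \<open>Expanding twice by the derivation rules, the double brackets that arise are
  \<open>[f0, [f0, f1]]\<close> and, from the part \<open>\<alpha> f1\<close> of the drift, the
  square of \<open>ad f1\<close> on \<open>f0\<close>. Only their coefficients matter later; the
  rest is kept as unspecified smooth \<open>s\<close> and \<open>t\<close>.\<close>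

lemma bracket_feedback:
  assumes f: "vector_field A f0" "vector_field A f1" and \<alpha>: "smooth_fun A \<alpha>" and \<beta>: "smooth_fun A \<beta>"
  obtains s t where "smooth_fun A s" "smooth_fun A t"
    and "lie_bracket (f0 + \<alpha> \<cdot> f1) (lie_bracket (f0 + \<alpha> \<cdot> f1) (\<beta> \<cdot> f1)) =
      \<beta> \<cdot> lie_bracket f0 (lie_bracket f0 f1) + (\<lambda>p. - (\<alpha> p * \<beta> p)) \<cdot> ad_pow f1 2 f0
      + s \<cdot> ad_pow f1 1 f0 + t \<cdot> f1"
proof -
  let ?F = "f0 + \<alpha> \<cdot> f1" and ?V = "lie_bracket f0 f1"
  \<comment> \<open>What multiplies \<open>f1\<close> in \<open>[?F, \<beta> f1]\<close> once
    \<open>\<beta> ?V\<close> is split off.\<close>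
  define c where "c p = ?F p \<beta> - \<beta> p * f1 p \<alpha>" for p
  have F: "vector_field A ?F" and V: "vector_field A ?V"
    by (intro vfield_add vfield_fscale vfield_bracket f \<alpha>)+
  have c: "smooth_fun A c"
    unfolding c_def[abs_def] by (intro smooth_fun_diff smooth_fun_mult vfield_smooth[OF F] vfield_smooth[OF f(2)] \<alpha> \<beta>)
  have Ff1: "lie_bracket ?F f1 = ?V + (\<lambda>p. - f1 p \<alpha>) \<cdot> f1"
    by (simp add: bracket_add_left bracket_fscale_left bracket_self f \<alpha> vfield_fscale vfield_simps)
  have FF1: "lie_bracket ?F (\<beta> \<cdot> f1) = \<beta> \<cdot> ?V + c \<cdot> f1"
    unfolding bracket_fscale_right[OF F f(2) \<beta>] Ff1
    by (simp add: vfield_simps c_def algebra_simps)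
  have FV: "lie_bracket ?F ?V = lie_bracket f0 ?V + ((\<lambda>p. - ?V p \<alpha>) \<cdot> f1 + \<alpha> \<cdot> lie_bracket f1 ?V)"
    by (simp add: bracket_add_left bracket_fscale_left f \<alpha> V vfield_fscale)
  have V_ad: "?V = (\<lambda>p. - 1) \<cdot> ad_pow f1 1 f0"
    by (simp add: bracket_swap[of f0])
  have f1V: "lie_bracket f1 ?V = (\<lambda>p. - 1) \<cdot> ad_pow f1 2 f0"
  proof -
    \<comment> \<open>Derivations kill constants: the product rule for \<open>1 * 1\<close> gives 0
      on 1, and scaling extends this to -1.\<close>
    have "f1 p (\<lambda>q. - 1) = 0" for p
      using tangent_scale[OF vfield_tangent[OF f(2)] smooth_fun_const, of p "- 1" 1]
        tangent_mult[OF vfield_tangent[OF f(2)] smooth_fun_const smooth_fun_const, of p 1 1] by simp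
    then show ?thesis
      unfolding V_ad
      by (subst bracket_fscale_right) (auto simp: f vfield_bracket smooth_fun_const numeral_2_eq_2 vfield_simps)
  qed
  have "lie_bracket ?F (lie_bracket ?F (\<beta> \<cdot> f1)) =
      ((\<lambda>p. ?F p \<beta>) \<cdot> ?V + \<beta> \<cdot> lie_bracket ?F ?V) + ((\<lambda>p. ?F p c) \<cdot> f1 + c \<cdot> lie_bracket ?F f1)"
    unfolding FF1 by (simp add: bracket_add_right bracket_fscale_right F V f c \<beta> vfield_fscale)
  also have "\<dots> = \<beta> \<cdot> lie_bracket f0 ?V + (\<lambda>p. - (\<alpha> p * \<beta> p)) \<cdot> ad_pow f1 2 f0
      + (\<lambda>p. - ?F p \<beta> - c p) \<cdot> ad_pow f1 1 f0
      + (\<lambda>p. - (\<beta> p * ?V p \<alpha>) + ?F p c - c p * f1 p \<alpha>) \<cdot> f1"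
  proof -
    have V_apply: "?V p f = - ad_pow f1 1 f0 p f" for p f
      by (subst V_ad) (simp add: fscale_apply)
    show ?thesis
      unfolding FV Ff1 f1V
      by (simp add: vfield_simps V_apply algebra_simps)
  qed
  finally show thesis
    by (rule that[rotated 2])
       (intro smooth_fun_diff smooth_fun_add smooth_fun_minus smooth_fun_mult
          vfield_smooth[OF F] vfield_smooth[OF V] vfield_smooth[OF f(2)] \<alpha> \<beta> c)+
qed

text \<open>As \<open>[g1, \<delta> g1] = g1(\<delta>) g1\<close>, changing the drift along
  \<open>g1\<close> changes every iterated bracket only along \<open>g1\<close>; the coefficients
  start from \<open>\<gamma>\<close> and are differentiated along \<open>g1\<close> at each
  step.\<close>

lemma ad_pow_add_fscale:
  assumes g: "vector_field A g0" "vector_field A g1" and \<gamma>: "smooth_fun A \<gamma>"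
  obtains \<delta> where "\<And>k. smooth_fun A (\<delta> k)"
    and "\<And>k. ad_pow g1 k (g0 + \<gamma> \<cdot> g1) = ad_pow g1 k g0 + \<delta> k \<cdot> g1"
proof -
  have "\<exists>\<delta>. smooth_fun A \<delta> \<and> ad_pow g1 k (g0 + \<gamma> \<cdot> g1) = ad_pow g1 k g0 + \<delta> \<cdot> g1" for k
  proof (induction k)
    case 0
    then show ?case using \<gamma> by auto
  next
    case (Suc k)
    then obtain \<delta> where \<delta>: "smooth_fun A \<delta>" "ad_pow g1 k (g0 + \<gamma> \<cdot> g1) = ad_pow g1 k g0 + \<delta> \<cdot> g1"
      by blast
    have "g \<cdot> (0 :: 'm vfield) = 0" for g
      by (simp add: vfield_simps)
    then have "ad_pow g1 (Suc k) (g0 + \<gamma> \<cdot> g1) = ad_pow g1 (Suc k) g0 + (\<lambda>p. g1 p \<delta>) \<cdot> g1"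
      using \<delta> by (simp add: bracket_add_right bracket_fscale_right bracket_self g vfield_fscale vfield_ad_pow)
    then show ?case
      using vfield_smooth[OF g(2) \<delta>(1)] by blast
  qed
  then show thesis using that by metis
qed

end

section \<open>Feedback normal form\<close>

text \<open>The frame of the first dimension condition, ordered so that the index is the exponent of
  \<open>ad g1\<close> and the drift has index 0. The exponents end at \<open>n - 2\<close>, which
  leaves the last index \<open>n - 1\<close> for \<open>g1\<close>.\<close>

definition ad_frame :: "nat \<Rightarrow> 'm vfield \<Rightarrow> 'm vfield \<Rightarrow> nat \<Rightarrow> 'm vfield" where
  "ad_frame n g0 g1 k = (if k < n - 1 then ad_pow g1 k g0 else g1)"

lemma ad_frame_image_tail:
  assumes "2 \<le> n"
  shows "(\<lambda>k. ad_frame n g0 g1 k p) ` {1..<n} =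
    insert (g1 p) {ad_pow g1 k g0 p | k. 1 \<le> k \<and> k \<le> n - 2}"
proof -
  have "{1..<n} = insert (n - 1) {1..n - 2}" using assms by auto
  moreover have "(\<lambda>k. ad_frame n g0 g1 k p) ` {1..n - 2} = {ad_pow g1 k g0 p | k. 1 \<le> k \<and> k \<le> n - 2}"
    using assms by (auto simp: ad_frame_def image_def)
  ultimately show ?thesis by (simp add: ad_frame_def)
qed

lemma ad_frame_image:
  assumes "2 \<le> n"
  shows "(\<lambda>k. ad_frame n g0 g1 k p) ` {..<n} =
    insert (g0 p) ((\<lambda>k. ad_frame n g0 g1 k p) ` {1..<n})"
proof -
  have "{..<n} = insert 0 {1..<n}" using assms by auto
  then show ?thesis using assms by (simp add: ad_frame_def)
qed

lemma ad_frame_sum: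
  fixes c :: "nat \<Rightarrow> real"
  assumes "4 \<le> n"
  shows "(\<Sum>k<n. c k *\<^sub>R ad_frame n g0 g1 k p) f = c 0 * g0 p f + c 1 * ad_pow g1 1 g0 p f +
    c 2 * ad_pow g1 2 g0 p f + (\<Sum>k = 3..n - 2. c k * ad_pow g1 k g0 p f) + c (n - 1) * g1 p f"
proof -
  have split: "{..<n} = insert 0 (insert 1 (insert 2 (insert (n - 1) {3..n - 2})))"
    using assms by auto
  have "(\<Sum>k = 3..n - 2. c k * ad_frame n g0 g1 k p f) = (\<Sum>k = 3..n - 2. c k * ad_pow g1 k g0 p f)"
    using assms by (intro sum.cong) (auto simp: ad_frame_def)
  moreover have "(\<Sum>k<n. c k * ad_frame n g0 g1 k p f) = c 0 * ad_frame n g0 g1 0 p f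
      + (c 1 * ad_frame n g0 g1 1 p f + (c 2 * ad_frame n g0 g1 2 p f
      + (c (n - 1) * ad_frame n g0 g1 (n - 1) p f + (\<Sum>k = 3..n - 2. c k * ad_frame n g0 g1 k p f))))"
  proof -
    have "n - 1 \<notin> {3..n - 2}" "n - 1 \<noteq> 0" "n - 1 \<noteq> 1" "n - 1 \<noteq> 2"
      using assms by auto
    then show ?thesis
      unfolding split by simp
  qed
  moreover have "0 < n - 1" "1 < n - 1" "2 < n - 1"
    using assms by auto
  ultimately show ?thesis
    by (simp add: sum_fun_apply scaleR_fun_def ad_frame_def)
qed

context atlas
begin

section \<open>Frames and their spans under feedback\<close>

lemma ad_frame_vfield:
  "vector_field A g0 \<Longrightarrow> vector_field A g1 \<Longrightarrow> vector_field A (ad_frame n g0 g1 k)"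
  by (simp add: ad_frame_def vfield_ad_pow)

lemma ad_gens_at:
  assumes "2 \<le> n"
  shows "(\<lambda>Y. Y p) ` ad_gens g0 g1 (n - 2) = (\<lambda>k. ad_frame n g0 g1 k p) ` {1..<n}"
  unfolding ad_frame_image_tail[OF assms] by (auto simp: ad_gens_def)

lemma smooth_module_sum:
  "(\<And>k. k \<in> K \<Longrightarrow> X k \<in> smooth_module S) \<Longrightarrow> (\<Sum>k\<in>K. X k) \<in> smooth_module S"
proof (induction K rule: infinite_finite_induct)
  case (insert k K)
  show ?case
    unfolding sum.insert[OF insert.hyps] by (intro smooth_module.add insert.IH insert.prems) auto
qed (simp_all add: smooth_module.zero)

lemma smooth_module_diff:
  assumes "X \<in> smooth_module S" "Y \<in> smooth_module S"
  shows "X + (\<lambda>p. - 1) \<cdot> Y \<in> smooth_module S"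
  by (intro smooth_module.add smooth_module.fscale smooth_fun_const assms)

lemma ad_frame_tail_in_module:
  assumes "\<And>k. k \<in> {1..<n} \<Longrightarrow> smooth_fun A (c k)"
  shows "(\<Sum>k\<in>{1..<n}. c k \<cdot> ad_frame n g0 g1 k) \<in> smooth_module (ad_gens g0 g1 (n - 2))"
  by (intro smooth_module_sum smooth_module.fscale assms smooth_module.base)
     (auto simp: ad_frame_def ad_gens_def)

lemma ad_frame_span_feedback_subset:
  assumes n: "2 \<le> n" and g: "vector_field A g0" "vector_field A g1"
    and \<alpha>: "smooth_fun A \<alpha>" and \<beta>: "smooth_fun A \<beta>"
  shows "span ((\<lambda>k. ad_frame n (g0 + \<alpha> \<cdot> g1) (\<beta> \<cdot> g1) k p) ` {..<n})
    \<subseteq> span ((\<lambda>k. ad_frame n g0 g1 k p) ` {..<n})" (is "span ?L \<subseteq> span ?R")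
proof (rule span_minimal[OF _ subspace_span])
  let ?S = "(\<lambda>k. ad_frame n g0 g1 k p) ` {1..<n}"
  have sub: "span ?S \<subseteq> span ?R"
    by (rule span_mono) auto
  have "Y p \<in> span ?S" if "Y \<in> ad_gens (g0 + \<alpha> \<cdot> g1) (\<beta> \<cdot> g1) (n - 2)" for Y
    using smooth_module_at[of Y "ad_gens g0 g1 (n - 2)" p] that
      smooth_module_feedback[OF g \<alpha> \<beta>, of "n - 2"] smooth_module.base[OF that]
    unfolding ad_gens_at[OF n] by blast
  then have "(\<lambda>k. ad_frame n (g0 + \<alpha> \<cdot> g1) (\<beta> \<cdot> g1) k p) ` {1..<n} \<subseteq> span ?R"
    unfolding ad_gens_at[OF n, of p "g0 + \<alpha> \<cdot> g1" "\<beta> \<cdot> g1", symmetric] using sub by blast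
  moreover have "(g0 + \<alpha> \<cdot> g1) p \<in> span ?R"
  proof -
    have "g0 p \<in> span ?R" "g1 p \<in> span ?R"
      unfolding ad_frame_image[OF n] ad_frame_image_tail[OF n] by (auto intro: span_base)
    then have "g0 p + \<alpha> p *\<^sub>R g1 p \<in> span ?R"
      by (intro span_add span_scale)
    then show ?thesis by (simp add: plus_fun_def fscale_at)
  qed
  ultimately show "?L \<subseteq> span ?R"
    by (subst ad_frame_image[OF n]) blast
qed

text \<open>Feedback transformations are invertible, so the reverse inclusion is the subset
  statement for the inverse transformation.\<close>

lemma ad_frame_span_feedback:
  assumes n: "2 \<le> n" and g: "vector_field A g0" "vector_field A g1"
    and \<alpha>: "smooth_fun A \<alpha>" and \<beta>: "smooth_fun A \<beta>" "\<And>p. \<beta> p \<noteq> 0"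
  shows "span ((\<lambda>k. ad_frame n (g0 + \<alpha> \<cdot> g1) (\<beta> \<cdot> g1) k p) ` {..<n})
    = span ((\<lambda>k. ad_frame n g0 g1 k p) ` {..<n})"
proof (rule antisym)
  let ?g0 = "g0 + \<alpha> \<cdot> g1" and ?g1 = "\<beta> \<cdot> g1"
  \<comment> \<open>The inverse transformation: \<open>g1 = ?g1 / \<beta>\<close> and
    \<open>g0 = ?g0 - (\<alpha> / \<beta>) ?g1\<close>.\<close>
  define \<beta>' where "\<beta>' p = inverse (\<beta> p)" for p
  define \<alpha>' where "\<alpha>' p = - (\<alpha> p * inverse (\<beta> p))" for p
  have smooth: "smooth_fun A \<beta>'" "smooth_fun A \<alpha>'"
    unfolding \<alpha>'_def[abs_def] \<beta>'_def[abs_def]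
    by (intro smooth_fun_minus smooth_fun_mult smooth_fun_inverse \<alpha> \<beta>)+
  have "?g0 + \<alpha>' \<cdot> ?g1 = g0" "\<beta>' \<cdot> ?g1 = g1"
    using \<beta>(2) by (simp_all add: vfield_simps \<alpha>'_def \<beta>'_def)
  with ad_frame_span_feedback_subset[OF n vfield_add[OF g(1) vfield_fscale[OF \<alpha> g(2)]]
      vfield_fscale[OF \<beta>(1) g(2)] smooth(2,1), of p]
  show "span ((\<lambda>k. ad_frame n g0 g1 k p) ` {..<n}) \<subseteq> span ((\<lambda>k. ad_frame n ?g0 ?g1 k p) ` {..<n})"
    by simp
qed (rule ad_frame_span_feedback_subset[OF n g \<alpha> \<beta>(1)])

text \<open>At \<open>p\<close>, elements of the module are combinations of the frame vectors other
  than \<open>g0\<close>, and the frame is independent. This justifies comparing coefficients of the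
  drift modulo the module.\<close>

lemma ad_frame_drift_independent:
  assumes n: "2 \<le> n" and dim: "dim (span ((\<lambda>k. ad_frame n g0 g1 k p) ` {..<n})) = n"
    and Z: "Z \<in> smooth_module (ad_gens g0 g1 (n - 2))" and eq: "r *\<^sub>R g0 p = Z p"
  shows "r = 0"
proof -
  have mem: "r *\<^sub>R g0 p \<in> span ((\<lambda>k. ad_frame n g0 g1 k p) ` {1..<n})"
    using smooth_module_at[OF Z, of p] unfolding ad_gens_at[OF n] eq .
  obtain c where c: "r *\<^sub>R g0 p = (\<Sum>k\<in>{1..<n}. c k *\<^sub>R ad_frame n g0 g1 k p)"
    by (rule span_image_sum[OF finite_atLeastLessThan mem])
  let ?c = "\<lambda>k. if k = 0 then r else - c k"
  have "{..<n} = insert 0 {1..<n}" using n by auto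
  then have "(\<Sum>k<n. ?c k *\<^sub>R ad_frame n g0 g1 k p) =
      r *\<^sub>R g0 p + (\<Sum>k\<in>{1..<n}. ?c k *\<^sub>R ad_frame n g0 g1 k p)"
    using n by (simp add: ad_frame_def)
  also have "(\<Sum>k\<in>{1..<n}. ?c k *\<^sub>R ad_frame n g0 g1 k p) =
      - (\<Sum>k\<in>{1..<n}. c k *\<^sub>R ad_frame n g0 g1 k p)"
    unfolding sum_negf[symmetric] by (rule sum.cong) auto
  finally have "(\<Sum>k<n. ?c k *\<^sub>R ad_frame n g0 g1 k p) = 0"
    using c by (simp add: zero_fun_def)
  from dim_card_imp_zero[OF dim this, of 0] n show ?thesis by simp
qed

text \<open>Replacing the drift by \<open>g0 + \<gamma> g1\<close> changes the coefficient of
  \<open>ad_pow g1 2 g0\<close> in the double bracket from \<open>b 2\<close> to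
  \<open>b 2 - \<gamma>\<close>, while the normal form has no such term. The drift coefficient is 1
  on both sides by the assumption on \<open>b 0\<close>, and all others can be matched by choosing
  the \<open>I k\<close>.\<close>

lemma normal_form_iff:
  fixes b :: "nat \<Rightarrow> 'm \<Rightarrow> real"
  assumes n: "4 \<le> n" and g: "vector_field A g0" "vector_field A g1"
    and dim: "\<And>p. dim (span ((\<lambda>k. ad_frame n g0 g1 k p) ` {..<n})) = n"
    and b: "\<And>k. k < n \<Longrightarrow> smooth_fun A (b k)" "\<And>p. b 0 p = 1"
    and W: "\<And>p. lie_bracket g0 (lie_bracket g0 g1) p = (\<Sum>k<n. b k p *\<^sub>R ad_frame n g0 g1 k p)"
    and \<gamma>: "smooth_fun A \<gamma>"
  defines "F0 \<equiv> g0 + \<gamma> \<cdot> g1"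
  shows "(\<exists>I :: nat \<Rightarrow> 'm \<Rightarrow> real. (\<forall>k\<in>{1..n - 2}. smooth_fun A (I k)) \<and>
      lie_bracket F0 (lie_bracket F0 g1) =
        F0 + I 1 \<cdot> g1 + I 2 \<cdot> lie_bracket g1 F0 + (\<Sum>k = 3..n - 2. I k \<cdot> ad_pow g1 k F0))
    \<longleftrightarrow> \<gamma> = b 2"
proof -
  obtain s t where st: "smooth_fun A s" "smooth_fun A t"
    and LHS: "lie_bracket F0 (lie_bracket F0 g1) =
      lie_bracket g0 (lie_bracket g0 g1) + (\<lambda>p. - \<gamma> p) \<cdot> ad_pow g1 2 g0
      + s \<cdot> ad_pow g1 1 g0 + t \<cdot> g1"
    using bracket_feedback[OF g \<gamma> smooth_fun_const[of 1]] unfolding fscale_const_one F0_def mult_1_right by metis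
  obtain \<delta> where \<delta>: "\<And>k. smooth_fun A (\<delta> k)"
    "\<And>k. ad_pow g1 k F0 = ad_pow g1 k g0 + \<delta> k \<cdot> g1"
    by (rule ad_pow_add_fscale[OF g \<gamma>, folded F0_def], rule that)
  \<comment> \<open>The coefficient of \<open>g1\<close> on the normal-form side once every
    \<open>ad_pow g1 k F0\<close> is rewritten in terms of \<open>g0\<close>; the summand
    \<open>\<gamma>\<close> comes from \<open>F0\<close> itself.\<close>
  let ?rest = "\<lambda>I p. \<gamma> p + I 1 p + I 2 p * \<delta> 1 p + (\<Sum>k = 3..n - 2. I k p * \<delta> k p)"
  have L: "lie_bracket F0 (lie_bracket F0 g1) p f = g0 p f + (b 1 p + s p) * ad_pow g1 1 g0 p f
      + (b 2 p - \<gamma> p) * ad_pow g1 2 g0 p f + (\<Sum>k = 3..n - 2. b k p * ad_pow g1 k g0 p f)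
      + (b (n - 1) p + t p) * g1 p f" for p f
    unfolding LHS vfield_add_apply fscale_apply W ad_frame_sum[OF n] b(2)
    by (simp add: algebra_simps del: ad_pow_Suc)
  have R: "(F0 + I 1 \<cdot> g1 + I 2 \<cdot> lie_bracket g1 F0 + (\<Sum>k = 3..n - 2. I k \<cdot> ad_pow g1 k F0)) p f =
      g0 p f + I 2 p * ad_pow g1 1 g0 p f + (\<Sum>k = 3..n - 2. I k p * ad_pow g1 k g0 p f)
      + ?rest I p * g1 p f" for I :: "nat \<Rightarrow> 'm \<Rightarrow> real" and p f
  proof -
    have "(\<Sum>k = 3..n - 2. I k p * (ad_pow g1 k g0 p f + \<delta> k p * g1 p f)) =
      (\<Sum>k = 3..n - 2. I k p * ad_pow g1 k g0 p f) + (\<Sum>k = 3..n - 2. I k p * \<delta> k p) * g1 p f"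
      by (simp add: sum.distrib sum_distrib_right distrib_left mult.assoc)
    moreover have "lie_bracket g1 F0 p f = ad_pow g1 1 g0 p f + \<delta> 1 p * g1 p f"
      using \<delta>(2)[of 1] by (simp add: vfield_simps)
    moreover have "F0 p f = g0 p f + \<gamma> p * g1 p f"
      by (simp add: F0_def fscale_apply)
    ultimately show ?thesis
      unfolding vfield_add_apply fscale_apply sum_fun_apply \<delta>(2) by (simp add: algebra_simps)
  qed
  show ?thesis
  proof (rule iffI)
    assume "\<exists>I :: nat \<Rightarrow> 'm \<Rightarrow> real. (\<forall>k\<in>{1..n - 2}. smooth_fun A (I k)) \<and>
      lie_bracket F0 (lie_bracket F0 g1) =
        F0 + I 1 \<cdot> g1 + I 2 \<cdot> lie_bracket g1 F0 + (\<Sum>k = 3..n - 2. I k \<cdot> ad_pow g1 k F0)"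
    then obtain I :: "nat \<Rightarrow> 'm \<Rightarrow> real" where I: "lie_bracket F0 (lie_bracket F0 g1) =
        F0 + I 1 \<cdot> g1 + I 2 \<cdot> lie_bracket g1 F0 + (\<Sum>k = 3..n - 2. I k \<cdot> ad_pow g1 k F0)"
      by blast
    show "\<gamma> = b 2"
    proof
      fix p
      \<comment> \<open>Left coefficients minus right coefficients in the frame. Index
        \<open>n - 1\<close> belongs to \<open>g1\<close> and differs from 0, 1 and 2 because
        \<open>n \<ge> 4\<close>.\<close>
      define d where "d k = (if k = 0 then 0 else if k = 1 then b 1 p + s p - I 2 p
        else if k = 2 then b 2 p - \<gamma> p else if k = n - 1 then b (n - 1) p + t p - ?rest I p
        else b k p - I k p)" for k
      have d: "d 0 = 0" "d 1 = b 1 p + s p - I 2 p" "d 2 = b 2 p - \<gamma> p"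
        "d (n - 1) = b (n - 1) p + t p - ?rest I p"
      proof -
        have "n - 1 \<noteq> 0" "n - 1 \<noteq> 1" "n - 1 \<noteq> 2" using n by auto
        then show "d (n - 1) = b (n - 1) p + t p - ?rest I p" by (simp add: d_def)
      qed (simp_all add: d_def)
      have "(\<Sum>k<n. d k *\<^sub>R ad_frame n g0 g1 k p) f = 0" for f
      proof -
        have "(\<Sum>k = 3..n - 2. d k * ad_pow g1 k g0 p f) =
          (\<Sum>k = 3..n - 2. b k p * ad_pow g1 k g0 p f - I k p * ad_pow g1 k g0 p f)"
          using n by (intro sum.cong) (auto simp: d_def left_diff_distrib)
        then show ?thesis
          using L[of p f] unfolding I R ad_frame_sum[OF n] d sum_subtractf
          by (simp add: left_diff_distrib distrib_right del: ad_pow_Suc)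
      qed
      then have "(\<Sum>k<n. d k *\<^sub>R ad_frame n g0 g1 k p) = 0"
        by (simp add: fun_eq_iff)
      from dim_card_imp_zero[OF dim this, of 2] n show "\<gamma> p = b 2 p"
        by (simp add: d)
    qed
  next
    assume \<gamma>b: "\<gamma> = b 2"
    \<comment> \<open>\<open>I 2\<close> multiplies the first bracket and so takes the coefficient
      with index 1, while \<open>I k\<close> takes index \<open>k\<close> from 3 on.
      \<open>I 1\<close> then solves the equation for \<open>g1\<close>, in which the others occur
      through \<open>\<delta>\<close>.\<close>
    define I where "I k p = (if k = 1 then b (n - 1) p + t p - \<gamma> p - (b 1 p + s p) * \<delta> 1 p
        - (\<Sum>k = 3..n - 2. b k p * \<delta> k p)
      else if k = 2 then b 1 p + s p else b k p)" for k p
    have I: "I 1 p = b (n - 1) p + t p - \<gamma> p - (b 1 p + s p) * \<delta> 1 p - (\<Sum>k = 3..n - 2. b k p * \<delta> k p)"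
      "I 2 p = b 1 p + s p" "k \<in> {3..n - 2} \<Longrightarrow> I k p = b k p" for k p
      by (auto simp: I_def)
    have "smooth_fun A (I k)" if k: "k \<in> {1..n - 2}" for k
    proof -
      have "k = 1 \<or> k = 2 \<or> k \<in> {3..n - 2}" using k by auto
      then consider "k = 1" | "k = 2" | "k \<in> {3..n - 2}" by blast
      then show ?thesis
      proof cases
        case 1
        then have "I k = (\<lambda>p. b (n - 1) p + t p - \<gamma> p - (b 1 p + s p) * \<delta> 1 p
            - (\<Sum>k = 3..n - 2. b k p * \<delta> k p))"
          using I(1) by blast
        then show ?thesis
          using n by (auto intro!: smooth_fun_add smooth_fun_diff smooth_fun_mult smooth_fun_sum b st \<delta> \<gamma>)
      next
        case 2
        then have "I k = (\<lambda>p. b 1 p + s p)"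
          using I(2) by blast
        then show ?thesis
          using n by (auto intro!: smooth_fun_add b st)
      next
        case 3
        then have "I k = b k"
          using I(3) by blast
        then show ?thesis
          using 3 n by (auto intro!: b)
      qed
    qed
    moreover have "lie_bracket F0 (lie_bracket F0 g1) =
        F0 + I 1 \<cdot> g1 + I 2 \<cdot> lie_bracket g1 F0 + (\<Sum>k = 3..n - 2. I k \<cdot> ad_pow g1 k F0)"
    proof (intro ext)
      fix p f
      have sums: "(\<Sum>k = 3..n - 2. I k p * ad_pow g1 k g0 p f) = (\<Sum>k = 3..n - 2. b k p * ad_pow g1 k g0 p f)"
        "(\<Sum>k = 3..n - 2. I k p * \<delta> k p) = (\<Sum>k = 3..n - 2. b k p * \<delta> k p)"
        by (intro sum.cong; simp add: I(3))+
      have "?rest I p = b (n - 1) p + t p"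
        unfolding sums(2) I(1,2) by simp
      then show "lie_bracket F0 (lie_bracket F0 g1) p f =
        (F0 + I 1 \<cdot> g1 + I 2 \<cdot> lie_bracket g1 F0 + (\<Sum>k = 3..n - 2. I k \<cdot> ad_pow g1 k F0)) p f"
        unfolding L R sums(1) I(2) by (simp only: \<gamma>b) simp
    qed
    ultimately show "\<exists>I :: nat \<Rightarrow> 'm \<Rightarrow> real. (\<forall>k\<in>{1..n - 2}. smooth_fun A (I k)) \<and>
      lie_bracket F0 (lie_bracket F0 g1) =
        F0 + I 1 \<cdot> g1 + I 2 \<cdot> lie_bracket g1 F0 + (\<Sum>k = 3..n - 2. I k \<cdot> ad_pow g1 k F0)"
      by blast
  qed
qed

end

lemma scaleR_diff_one_eq:
  fixes x y w :: "'a::real_vector"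
  shows "c *\<^sub>R x + y = x + w \<Longrightarrow> (c - 1) *\<^sub>R x = w + (- 1) *\<^sub>R y"
  by (simp add: algebra_simps)

theorem proposition2:
  fixes A :: "('m::{t2_space, second_countable_topology}, 'n::finite) chart set"
    and f0 f1 :: "'m vfield"
    and n :: nat
  assumes "CARD('n) = n" and "n \<ge> 4"
    and "smooth_atlas A"
    and "vector_field A f0" and "vector_field A f1"
    and "\<And>p. dim (span ({f0 p, f1 p} \<union> {ad_pow f1 k f0 p | k. 1 \<le> k \<and> k \<le> n - 2})) = n"
    and "\<And>p. dim (span ({f1 p, lie_bracket f0 (lie_bracket f0 f1) p}
                 \<union> {ad_pow f1 k f0 p | k. 1 \<le> k \<and> k \<le> n - 2})) = n"
  shows "\<exists>!F. F \<in> feedback_orbit A f0 f1 \<and>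
           (case F of (F0, F1) \<Rightarrow>
             \<exists>I :: nat \<Rightarrow> 'm \<Rightarrow> real. (\<forall>k\<in>{1..n - 2}. smooth_fun A (I k)) \<and>
               lie_bracket F0 (lie_bracket F0 F1) =
                 F0 + I 1 \<cdot> F1 + I 2 \<cdot> lie_bracket F1 F0
                 + (\<Sum>k = 3..n - 2. I k \<cdot> ad_pow F1 k F0))"
proof -
  interpret atlas A
    by unfold_locales (rule assms(3))
  note n = assms(2) and f = assms(4,5)
  have n2: "2 \<le> n" using n by simp
  let ?W = "lie_bracket f0 (lie_bracket f0 f1)"
  let ?normal = "\<lambda>F0 F1. \<exists>I :: nat \<Rightarrow> 'm \<Rightarrow> real. (\<forall>k\<in>{1..n - 2}. smooth_fun A (I k)) \<and>
    lie_bracket F0 (lie_bracket F0 F1) =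
      F0 + I 1 \<cdot> F1 + I 2 \<cdot> lie_bracket F1 F0 + (\<Sum>k = 3..n - 2. I k \<cdot> ad_pow F1 k F0)"
  let ?mod = "smooth_module (ad_gens f0 f1 (n - 2))"
  have gens: "f1 \<in> ?mod" "1 \<le> k \<Longrightarrow> k \<le> n - 2 \<Longrightarrow> ad_pow f1 k f0 \<in> ?mod" for k
    by (rule smooth_module.base; simp add: ad_gens_def)+
  have dim: "dim (span ((\<lambda>k. ad_frame n f0 f1 k p) ` {..<n})) = n" for p
    using assms(6)[of p] unfolding ad_frame_image[OF n2] ad_frame_image_tail[OF n2]
    by (simp only: Un_insert_left Un_empty_left)
  obtain a where a: "\<And>k. k < n \<Longrightarrow> smooth_fun A (a k)"
    "\<And>p. ?W p = (\<Sum>k<n. a k p *\<^sub>R ad_frame n f0 f1 k p)"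
    by (rule frame_decomposition[of "ad_frame n f0 f1" ?W, unfolded assms(1),
          OF ad_frame_vfield[OF f] vfield_bracket[OF f(1) vfield_bracket[OF f]] dim], rule that)
  have split: "{..<n} = insert 0 {1..<n}" using n by auto
  \<comment> \<open>The part of \<open>?W\<close> that avoids the drift; modulo \<open>?mod\<close>
    only \<open>a 0\<close> times \<open>f0\<close> is left of \<open>?W\<close>.\<close>
  define Z where "Z = ?W + (\<lambda>p. - a 0 p) \<cdot> f0"
  have W_Z: "?W p = a 0 p *\<^sub>R f0 p + (\<Sum>k\<in>{1..<n}. a k p *\<^sub>R ad_frame n f0 f1 k p)" for p
    unfolding a(2) split using n by (simp add: ad_frame_def)
  \<comment> \<open>If \<open>a 0\<close> vanished at \<open>p\<close>, all vectors of the second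
    dimension condition would lie in the span of the \<open>n - 1\<close> frame vectors other than
    \<open>f0\<close>.\<close>
  have a0: "a 0 p \<noteq> 0" for p
  proof
    assume "a 0 p = 0"
    let ?T = "(\<lambda>k. ad_frame n f0 f1 k p) ` {1..<n}"
    have "?W p \<in> span ?T"
      unfolding W_Z \<open>a 0 p = 0\<close> by (auto intro!: span_add span_sum span_scale intro: span_base span_zero)
    then have "{f1 p, ?W p} \<union> {ad_pow f1 k f0 p | k. 1 \<le> k \<and> k \<le> n - 2} \<subseteq> span ?T"
      unfolding ad_frame_image_tail[OF n2] by (auto intro: span_base)
    then have "span ({f1 p, ?W p} \<union> {ad_pow f1 k f0 p | k. 1 \<le> k \<and> k \<le> n - 2}) \<subseteq> span ?T"
      by (rule span_minimal[OF _ subspace_span])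
    from dim_le_card[OF this] have "n \<le> card ?T"
      unfolding assms(7) by simp
    moreover have "card ?T \<le> n - 1"
      using card_image_le[of "{1..<n}" "\<lambda>k. ad_frame n f0 f1 k p"] by simp
    ultimately show False using n by simp
  qed
  have Z: "Z = (\<Sum>k\<in>{1..<n}. a k \<cdot> ad_frame n f0 f1 k)"
    by (rule ext) (simp add: Z_def plus_fun_apply fscale_at W_Z sum_fun_apply)
  have Z_mod: "Z \<in> ?mod"
    unfolding Z by (intro ad_frame_tail_in_module a) simp
  \<comment> \<open>Over the whole orbit the double bracket has drift coefficient
    \<open>\<beta> a 0\<close> modulo one fixed module; \<open>\<alpha>\<close> contributes only to
    the module part.\<close>
  have orbit_mod: "\<exists>Y\<in>?mod. lie_bracket (f0 + \<alpha> \<cdot> f1) (lie_bracket (f0 + \<alpha> \<cdot> f1) (\<beta> \<cdot> f1)) =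
      (\<lambda>p. \<beta> p * a 0 p) \<cdot> f0 + Y" if \<alpha>: "smooth_fun A \<alpha>" and \<beta>: "smooth_fun A \<beta>" for \<alpha> \<beta>
  proof -
    obtain s t where st: "smooth_fun A s" "smooth_fun A t"
      and eq: "lie_bracket (f0 + \<alpha> \<cdot> f1) (lie_bracket (f0 + \<alpha> \<cdot> f1) (\<beta> \<cdot> f1)) =
        \<beta> \<cdot> ?W + (\<lambda>p. - (\<alpha> p * \<beta> p)) \<cdot> ad_pow f1 2 f0 + s \<cdot> ad_pow f1 1 f0 + t \<cdot> f1"
      by (rule bracket_feedback[OF f \<alpha> \<beta>])
    let ?Y = "\<beta> \<cdot> Z + (\<lambda>p. - (\<alpha> p * \<beta> p)) \<cdot> ad_pow f1 2 f0 + s \<cdot> ad_pow f1 1 f0 + t \<cdot> f1"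
    have "?Y \<in> ?mod"
      using n by (intro smooth_module.add smooth_module.fscale Z_mod gens \<alpha> \<beta> st smooth_fun_minus
          smooth_fun_mult) auto
    moreover have "\<beta> \<cdot> ?W + (\<lambda>p. - (\<alpha> p * \<beta> p)) \<cdot> ad_pow f1 2 f0 + s \<cdot> ad_pow f1 1 f0 + t \<cdot> f1 =
        (\<lambda>p. \<beta> p * a 0 p) \<cdot> f0 + ?Y"
      by (simp add: vfield_simps Z_def algebra_simps del: ad_pow_Suc)
    ultimately show ?thesis unfolding eq by blast
  qed
  \<comment> \<open>The factor that makes the drift coefficient \<open>\<beta> a 0\<close> equal to
    1, as the normal form demands.\<close>
  define \<beta> where "\<beta> p = inverse (a 0 p)" for p
  have \<beta>: "smooth_fun A \<beta>" "\<And>p. \<beta> p \<noteq> 0"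
    unfolding \<beta>_def[abs_def] using a(1)[of 0] a0 n by (auto intro: smooth_fun_inverse)
  let ?g1 = "\<beta> \<cdot> f1"
  \<comment> \<open>Rescaling \<open>f1\<close> alone is the feedback with
    \<open>\<alpha> = 0\<close>, which brings it under the general lemmas.\<close>
  have zero: "smooth_fun A (\<lambda>p. 0)" "f0 + (\<lambda>p. 0) \<cdot> f1 = f0"
    by (simp_all add: smooth_fun_const vfield_simps)
  have g1: "vector_field A ?g1"
    by (rule vfield_fscale[OF \<beta>(1) f(2)])
  have dim': "dim (span ((\<lambda>k. ad_frame n f0 ?g1 k p) ` {..<n})) = n" for p
    using ad_frame_span_feedback[OF n2 f zero(1) \<beta>, of p] dim[of p] unfolding zero(2) by simp
  let ?V = "lie_bracket f0 (lie_bracket f0 ?g1)"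
  obtain b where b: "\<And>k. k < n \<Longrightarrow> smooth_fun A (b k)"
    "\<And>p. ?V p = (\<Sum>k<n. b k p *\<^sub>R ad_frame n f0 ?g1 k p)"
    by (rule frame_decomposition[of "ad_frame n f0 ?g1" ?V, unfolded assms(1),
          OF ad_frame_vfield[OF f(1) g1] vfield_bracket[OF f(1) vfield_bracket[OF f(1) g1]] dim'], rule that)
  \<comment> \<open>Modulo \<open>?mod\<close>, the expansion in the new frame gives
    \<open>?V\<close> the drift coefficient \<open>b 0\<close>, since the new generators stay in
    that module, and \<open>orbit_mod\<close> gives \<open>\<beta> a 0 = 1\<close>.\<close>
  have b0: "b 0 p = 1" for p
  proof -
    obtain Y where Y: "Y \<in> ?mod" "?V = (\<lambda>p. \<beta> p * a 0 p) \<cdot> f0 + Y"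
      using orbit_mod[OF zero(1) \<beta>(1)] unfolding zero(2) by blast
    let ?tail = "\<Sum>k\<in>{1..<n}. b k \<cdot> ad_frame n f0 ?g1 k"
    have "?tail \<in> smooth_module (ad_gens f0 ?g1 (n - 2))"
      by (intro ad_frame_tail_in_module b) simp
    then have tail: "?tail \<in> ?mod"
      using smooth_module_feedback[OF f zero(1) \<beta>(1)] unfolding zero(2) by blast
    have "?V p = b 0 p *\<^sub>R f0 p + ?tail p"
      unfolding b(2) split using n by (simp add: ad_frame_def sum_fun_apply fscale_at)
    moreover have "?V p = f0 p + Y p"
      unfolding Y(2) using a0[of p] by (simp add: plus_fun_def fscale_at \<beta>_def)
    ultimately have "(b 0 p - 1) *\<^sub>R f0 p = (Y + (\<lambda>p. - 1) \<cdot> ?tail) p"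
      by (simp add: fscale_at algebra_simps)
    from ad_frame_drift_independent[OF n2 dim smooth_module_diff[OF Y(1) tail] this]
    show ?thesis by simp
  qed
  have iff: "?normal (f0 + \<gamma> \<cdot> ?g1) ?g1 \<longleftrightarrow> \<gamma> = b 2" if "smooth_fun A \<gamma>" for \<gamma>
    using normal_form_iff[OF n f(1) g1 dim' b(1) b0 b(2) that] .
  \<comment> \<open>In the normal form everything but \<open>f0\<close> lies in \<open>?mod\<close>,
    so its drift coefficient is 1; \<open>orbit_mod\<close> gives \<open>\<beta>' a 0\<close> for
    the same vector field.\<close>
  have \<beta>_unique: "\<beta>' = \<beta>" if \<alpha>': "smooth_fun A \<alpha>'" and \<beta>': "smooth_fun A \<beta>'"
    and normal: "?normal (f0 + \<alpha>' \<cdot> f1) (\<beta>' \<cdot> f1)" for \<alpha>' \<beta>'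
  proof
    fix p
    let ?F0 = "f0 + \<alpha>' \<cdot> f1" and ?F1 = "\<beta>' \<cdot> f1"
    obtain Y where Y: "Y \<in> ?mod"
      "lie_bracket ?F0 (lie_bracket ?F0 ?F1) = (\<lambda>p. \<beta>' p * a 0 p) \<cdot> f0 + Y"
      using orbit_mod[OF \<alpha>' \<beta>'] by blast
    obtain I :: "nat \<Rightarrow> 'm \<Rightarrow> real" where I: "\<And>k. k \<in> {1..n - 2} \<Longrightarrow> smooth_fun A (I k)"
      "lie_bracket ?F0 (lie_bracket ?F0 ?F1) =
        ?F0 + I 1 \<cdot> ?F1 + I 2 \<cdot> lie_bracket ?F1 ?F0 + (\<Sum>k = 3..n - 2. I k \<cdot> ad_pow ?F1 k ?F0)"
      using normal by blast
    let ?tail = "I 1 \<cdot> ?F1 + I 2 \<cdot> ad_pow ?F1 1 ?F0 + (\<Sum>k = 3..n - 2. I k \<cdot> ad_pow ?F1 k ?F0)"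
    have gens': "?F1 \<in> smooth_module (ad_gens ?F0 ?F1 (n - 2))"
      "1 \<le> k \<Longrightarrow> k \<le> n - 2 \<Longrightarrow> ad_pow ?F1 k ?F0 \<in> smooth_module (ad_gens ?F0 ?F1 (n - 2))" for k
      by (rule smooth_module.base; simp add: ad_gens_def)+
    have "?tail \<in> smooth_module (ad_gens ?F0 ?F1 (n - 2))"
      by (intro smooth_module.add smooth_module.fscale[OF I(1) gens'(1)]
          smooth_module.fscale[OF I(1) gens'(2)] smooth_module_sum) (use n in auto)
    \<comment> \<open>The generators built from \<open>?F0\<close> and \<open>?F1\<close> are traded
      for those of \<open>f0\<close> and \<open>f1\<close>, to which \<open>dim\<close>
      applies.\<close>
    then have "?tail \<in> ?mod"
      using smooth_module_feedback[OF f \<alpha>' \<beta>'] by blast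
    then have tail: "\<alpha>' \<cdot> f1 + ?tail \<in> ?mod"
      by (intro smooth_module.add[OF smooth_module.fscale[OF \<alpha>' gens(1)]])
    have "(\<lambda>p. \<beta>' p * a 0 p) \<cdot> f0 + Y = f0 + (\<alpha>' \<cdot> f1 + ?tail)"
      using Y(2) I(2) by (simp add: add.assoc)
    then have "(\<beta>' p * a 0 p) *\<^sub>R f0 p + Y p = f0 p + (\<alpha>' \<cdot> f1 + ?tail) p"
      unfolding fscale_at[of "\<lambda>p. \<beta>' p * a 0 p", symmetric] plus_fun_apply[symmetric] by (rule fun_cong)
    then have "(\<beta>' p * a 0 p - 1) *\<^sub>R f0 p = ((\<alpha>' \<cdot> f1 + ?tail) + (\<lambda>p. - 1) \<cdot> Y) p"
      unfolding plus_fun_apply[of _ "(\<lambda>p. - 1) \<cdot> Y"] fscale_at[of "\<lambda>p. - 1"]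
      by (rule scaleR_diff_one_eq)
    then have "\<beta>' p * a 0 p - 1 = 0"
      by (rule ad_frame_drift_independent[OF n2 dim smooth_module_diff[OF tail Y(1)]])
    then have "a 0 p * \<beta>' p = 1"
      by (simp only: right_minus_eq mult.commute[of "a 0 p"])
    then show "\<beta>' p = \<beta> p"
      unfolding \<beta>_def by (rule inverse_unique[symmetric])
  qed
  have b2: "smooth_fun A (b 2)"
    using n by (intro b) simp
  show ?thesis
  \<comment> \<open>\<open>b 2\<close> is the multiplier relative to \<open>?g1\<close>; relative to
    \<open>f1\<close> the orbit parameter is \<open>b 2 * \<beta>\<close>.\<close>
  proof (rule ex1I[of _ "(f0 + b 2 \<cdot> ?g1, ?g1)"])
    show "(f0 + b 2 \<cdot> ?g1, ?g1) \<in> feedback_orbit A f0 f1 \<and>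
      (case (f0 + b 2 \<cdot> ?g1, ?g1) of (F0, F1) \<Rightarrow> ?normal F0 F1)"
      using iff[OF b2] smooth_fun_mult[OF b2 \<beta>(1)] \<beta>
      unfolding feedback_orbit_def fscale_fscale prod.case by blast
  next
    fix F assume F: "F \<in> feedback_orbit A f0 f1 \<and> (case F of (F0, F1) \<Rightarrow> ?normal F0 F1)"
    then obtain \<alpha>' \<beta>' where F_eq: "F = (f0 + \<alpha>' \<cdot> f1, \<beta>' \<cdot> f1)"
      and smooth: "smooth_fun A \<alpha>'" "smooth_fun A \<beta>'"
      unfolding feedback_orbit_def by blast
    with F have normal: "?normal (f0 + \<alpha>' \<cdot> f1) (\<beta>' \<cdot> f1)"
      unfolding F_eq prod.case by blast
    have \<beta>': "\<beta>' = \<beta>"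
      by (rule \<beta>_unique[OF smooth normal])
    \<comment> \<open>Since \<open>\<beta> a 0 = 1\<close>, the term \<open>\<alpha>' f1\<close> is
      \<open>\<gamma>\<close> times \<open>?g1\<close>, and \<open>iff\<close> applies.\<close>
    define \<gamma> where "\<gamma> p = \<alpha>' p * a 0 p" for p
    have "\<alpha>' \<cdot> f1 = \<gamma> \<cdot> ?g1"
      using a0 by (simp add: vfield_simps \<gamma>_def \<beta>_def)
    moreover have "smooth_fun A \<gamma>"
      unfolding \<gamma>_def[abs_def] using n by (intro smooth_fun_mult smooth a) simp
    ultimately show "F = (f0 + b 2 \<cdot> ?g1, ?g1)"
      using iff[of \<gamma>] normal unfolding F_eq \<beta>' by (simp only: simp_thms)
  qed
qed

end
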